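(* Let $(\mathcal N,\mathcal O,\mathfrak l)$ be a plabic network with perfect orientation $\mathcal O=\mathcal O(I)$ and gauge ray direction $\mathfrak l$. Let $\{B_j \mid j\in\bar I\}$ be $n-k$ linearly independent vectors assigned to the boundary sinks $b_j$, and let the vectors at the edges $e_j$ ending at $b_j$ be defined by $E_{e_j}=(-1)^{\mathrm{int}(e_j)}w_{e_j}B_j$, $j\in\bar I$. Consider the linear system formed by the equations at all internal vertices: - at each bivalent vertex with incoming edge $e$ and outgoing edge $f$: $E_e=(-1)^{\mathrm{int}(e)+\mathrm{wind}(e,f)}w_eE_f$; - at each trivalent black vertex with incoming edges $e_2,e_3$ and outgoing edge $e_1$: $E_{e_i}=(-1)^{\mathrm{int}(e_i)+\mathrm{wind}(e_i,e_1)}w_{e_i}E_{e_1}$, $i=2,3$; - at each trivalent white vertex with incoming edge $e_3$ and outgoing edges $e_1,e_2$: $E_{e_3}=(-1)^{\mathrm{int}(e_3)+\mathrm{wind}(e_3,e_1)}w_{e_3}E_{e_1}+(-1)^{\mathrm{int}(e_3)+\mathrm{wind}(e_3,e_2)}w_{e_3}E_{e_2}$, in the unknowns $E_e$, where $e$ ranges over the edges not ending at boundary sinks. Then the number of equations equals the number of unknowns and the system has full rank; therefore it is consistent and provides a unique system of edge vectors on $(\mathcal N,\mathcal O,\mathfrak l)$. Moreover, if variables and equations are properly ordered (the row of each equation having the same index as the edge on its left-hand side), the determinant of the matrix $M$ of this linear system is the sum of the weights of all conservative flows: $$\det M=\sum_{C\in\mathcal C(\mathcal G)}w(C).$$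
   Context: **Plabic networks.** Let $D$ be a closed convex disk whose boundary contains a straight segment. A plabic graph $\mathcal G$ is a finite directed planar graph embedded in $D$ with straight edges. It has boundary vertices $b_1,\dots,b_n$ on the segment, labelled clockwise, each of degree 1 (a source if its edge is outgoing, a sink otherwise). The remaining (internal) vertices lie inside $D$ and have degree 2 or 3. No component is isolated from the boundary. The graph is perfect: each internal vertex has exactly one incoming edge (then it is white) or exactly one outgoing edge (then it is black); a bivalent vertex has one incoming and one outgoing edge and is given either color. The orientation $\mathcal O$ is called a perfect orientation. $I=\{i_1<\dots<i_k\}$ is the set of indices of the boundary sources and $\bar I=[n]\setminus I$. A network $\mathcal N$ is $\mathcal G$ with a positive weight $w_e$ on each edge. **Gauge rays.** A gauge ray direction $\mathfrak l$ is an oriented direction, not parallel to any edge, such that the rays with direction $\mathfrak l$ starting at boundary vertices point inside $D$ and contain no internal vertices. The gauge rays are the rays $\mathfrak l_{i_r}$ starting at the boundary sources $b_{i_r}$. $\mathrm{int}(e)$ is the number of intersections of the edge $e$ with the gauge rays (the base point of a ray is not counted). **Winding.** For nonzero planar vectors, $s(a,b)=+1,0,-1$ if the ordered pair $(a,b)$ is positively oriented, parallel, negatively oriented respectively. For consecutive directed edges $e,f$: $\mathrm{wind}(e,f)=1$ if $s(e,f)=s(e,\mathfrak l)=s(\mathfrak l,f)=1$; $\mathrm{wind}(e,f)=-1$ if $s(e,f)=s(e,\mathfrak l)=s(\mathfrak l,f)=-1$; otherwise $0$. **Matrix $M$.** All terms with unknowns are moved to the left-hand side, so that the equation whose left-hand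 side is $E_e$ has coefficient $1$ at $E_e$; the terms with the given vectors at the boundary sinks form the inhomogeneous part. **Conservative flows.** A conservative flow $C$ is a collection of distinct edges, none incident to the boundary, such that at each internal vertex the number of edges of $C$ arriving equals the number of edges of $C$ leaving. $\mathcal C(\mathcal G)$ is the set of conservative flows, including the empty (trivial) one. $w(C)$ is the product of the weights of the edges of $C$, with weight $1$ for the trivial flow. *)

theory Defs
  imports
    "HOL-Analysis.Analysis"
    "HOL-Combinatorics.Multiset_Permutations"
    "Graph_Theory.Digraph_Component"
    "Jordan_Normal_Form.DL_Rank"
begin

section \<open>Plabic networks\<close>

datatype colour = White | Black

text \<open>
  The plane is the type of complex numbers. Vertices are points of the plane, and an arc \<open>e\<close> is
  drawn as the straight segment from its tail to its head, so the abstract digraph determines the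
  drawing. The boundary vertices \<open>b\<^sub>1, \<dots>, b\<^sub>n\<close> are \<open>bd N 1, \<dots>, bd N n\<close> with \<open>n = bd_num N\<close>.
\<close>

record 'e plabic_network =
  disk :: "complex set"
  bd_num :: nat
  bd :: "nat \<Rightarrow> complex"
  dig :: "(complex, 'e) pre_digraph"
  vcolour :: "complex \<Rightarrow> colour"
  weight :: "'e \<Rightarrow> real"

definition bd_verts :: "'e plabic_network \<Rightarrow> complex set" where
  "bd_verts N = bd N ` {1..bd_num N}"

definition internal_verts :: "'e plabic_network \<Rightarrow> complex set" where
  "internal_verts N = verts (dig N) - bd_verts N"

definition source_idx :: "'e plabic_network \<Rightarrow> nat set" where
  "source_idx N = {i \<in> {1..bd_num N}. out_degree (dig N) (bd N i) = 1}"

definition sink_idx :: "'e plabic_network \<Rightarrow> nat set" where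
  "sink_idx N = {1..bd_num N} - source_idx N"

definition edge_segment :: "'e plabic_network \<Rightarrow> 'e \<Rightarrow> complex set" where
  "edge_segment N e = closed_segment (tail (dig N) e) (head (dig N) e)"

definition edge_vec :: "'e plabic_network \<Rightarrow> 'e \<Rightarrow> complex" where
  "edge_vec N e = head (dig N) e - tail (dig N) e"

text \<open>\<open>Im (cnj a * b)\<close> is the determinant of the pair of planar vectors \<open>(a, b)\<close>.\<close>

definition orient :: "complex \<Rightarrow> complex \<Rightarrow> real" where
  "orient a b = sgn (Im (cnj a * b))"

text \<open>
  A closed convex disk is a compact convex set with nonempty interior. Going through the boundary
  clockwise leaves the disk on the right, hence the sign condition on the directed segment from
  \<open>p\<close> to \<open>q\<close>.
\<close>

definition disk_with_boundary_points :: "complex set \<Rightarrow> nat \<Rightarrow> (nat \<Rightarrow> complex) \<Rightarrow> bool" where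
  "disk_with_boundary_points D n b \<longleftrightarrow>
     compact D \<and> convex D \<and> interior D \<noteq> {} \<and>
     (\<exists>p q t. p \<noteq> q \<and> closed_segment p q \<subseteq> frontier D \<and>
        (\<forall>z\<in>D. orient (q - p) (z - p) \<le> 0) \<and>
        strict_mono_on {1..n} t \<and>
        (\<forall>i\<in>{1..n}. t i \<in> {0..1} \<and> b i = p + (t i :: real) *\<^sub>R (q - p)))"

text \<open>
  The last condition also excludes multiple arcs and antiparallel pairs of arcs, since these would
  be drawn as the same segment.
\<close>

definition straight_embedding :: "(complex, 'e) pre_digraph \<Rightarrow> bool" where
  "straight_embedding G \<longleftrightarrow>
     (\<forall>e\<in>arcs G. tail G e \<noteq> head G e) \<and>
     (\<forall>e\<in>arcs G. open_segment (tail G e) (head G e) \<inter> verts G = {}) \<and>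
     (\<forall>e\<in>arcs G. \<forall>f\<in>arcs G. e \<noteq> f \<longrightarrow>
        closed_segment (tail G e) (head G e) \<inter> closed_segment (tail G f) (head G f)
          \<subseteq> {tail G e, head G e} \<inter> {tail G f, head G f})"

text \<open>
  Condition \<open>perfect\<close> forces a vertex of degree 2 to have one incoming and one outgoing arc; such a
  vertex may carry either colour. Components are those of the underlying undirected graph.
\<close>

locale plabic =
  fixes N :: "'e plabic_network"
  assumes finite_graph: "fin_digraph (dig N)"
    and disk: "disk_with_boundary_points (disk N) (bd_num N) (bd N)"
    and embedding: "straight_embedding (dig N)"
    and bd_in_graph: "bd_verts N \<subseteq> verts (dig N)"
    and bd_degree: "v \<in> bd_verts N \<Longrightarrow> in_degree (dig N) v + out_degree (dig N) v = 1"
    and internal_in_disk: "internal_verts N \<subseteq> interior (disk N)"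
    and internal_degree:
      "v \<in> internal_verts N \<Longrightarrow> in_degree (dig N) v + out_degree (dig N) v \<in> {2, 3}"
    and perfect:
      "v \<in> internal_verts N \<Longrightarrow>
         (case vcolour N v of White \<Rightarrow> in_degree (dig N) v = 1
                            | Black \<Rightarrow> out_degree (dig N) v = 1)"
    and no_isolated_component:
      "v \<in> verts (dig N) \<Longrightarrow> \<exists>u\<in>bd_verts N. v \<rightarrow>\<^sup>*\<^bsub>with_proj (mk_symmetric (dig N))\<^esub> u"
    and weight_pos: "e \<in> arcs (dig N) \<Longrightarrow> weight N e > 0"


section \<open>Gauge rays, intersection and winding numbers\<close>

text \<open>The base point is not part of the ray.\<close>

definition ray :: "complex \<Rightarrow> complex \<Rightarrow> complex set" where
  "ray x l = {x + t *\<^sub>R l | t. t > 0}"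

definition gauge_direction :: "'e plabic_network \<Rightarrow> complex \<Rightarrow> bool" where
  "gauge_direction N l \<longleftrightarrow>
     l \<noteq> 0 \<and>
     (\<forall>e\<in>arcs (dig N). orient (edge_vec N e) l \<noteq> 0) \<and>
     (\<forall>x\<in>bd_verts N.
        (\<forall>\<^sub>F t in at_right 0. x + t *\<^sub>R l \<in> interior (disk N)) \<and>
        ray x l \<inter> internal_verts N = {})"

definition int_num :: "'e plabic_network \<Rightarrow> complex \<Rightarrow> 'e \<Rightarrow> nat" where
  "int_num N l e = card (SIGMA i:source_idx N. ray (bd N i) l \<inter> edge_segment N e)"

definition wind :: "'e plabic_network \<Rightarrow> complex \<Rightarrow> 'e \<Rightarrow> 'e \<Rightarrow> int" where
  "wind N l e f =
     (let a = edge_vec N e; b = edge_vec N f in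
      if orient a b = 1 \<and> orient a l = 1 \<and> orient l b = 1 then 1
      else if orient a b = -1 \<and> orient a l = -1 \<and> orient l b = -1 then -1
      else 0)"


section \<open>The linear system\<close>

definition edge_coeff :: "'e plabic_network \<Rightarrow> complex \<Rightarrow> 'e \<Rightarrow> 'e \<Rightarrow> real" where
  "edge_coeff N l e f = (-1) powi (int (int_num N l e) + wind N l e f) * weight N e"

text \<open>
  A pair \<open>(e, a)\<close> stands for the equation expressing the unknown at \<open>e\<close> as the linear combination
  of the vectors at all arcs \<open>f\<close> with coefficients \<open>a f\<close>.
\<close>

inductive_set vertex_equations :: "'e plabic_network \<Rightarrow> complex \<Rightarrow> ('e \<times> ('e \<Rightarrow> real)) set"
  for N :: "'e plabic_network" and l :: complex where
  bivalent:
    "\<lbrakk>v \<in> internal_verts N; in_arcs (dig N) v = {e}; out_arcs (dig N) v = {f}\<rbrakk> \<Longrightarrow>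
     (e, (\<lambda>_. 0)(f := edge_coeff N l e f)) \<in> vertex_equations N l"
| trivalent_black:
    "\<lbrakk>v \<in> internal_verts N; vcolour N v = Black;
      in_arcs (dig N) v = {e2, e3}; e2 \<noteq> e3; out_arcs (dig N) v = {e1}; e \<in> {e2, e3}\<rbrakk> \<Longrightarrow>
     (e, (\<lambda>_. 0)(e1 := edge_coeff N l e e1)) \<in> vertex_equations N l"
| trivalent_white:
    "\<lbrakk>v \<in> internal_verts N; vcolour N v = White;
      in_arcs (dig N) v = {e3}; out_arcs (dig N) v = {e1, e2}; e1 \<noteq> e2\<rbrakk> \<Longrightarrow>
     (e3, (\<lambda>_. 0)(e1 := edge_coeff N l e3 e1, e2 := edge_coeff N l e3 e2)) \<in> vertex_equations N l"

definition unknown_edges :: "'e plabic_network \<Rightarrow> 'e set" where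
  "unknown_edges N = {e \<in> arcs (dig N). head (dig N) e \<notin> bd N ` sink_idx N}"

definition edge_vectors ::
  "'e plabic_network \<Rightarrow> complex \<Rightarrow> (nat \<Rightarrow> 'v::real_vector) \<Rightarrow> ('e \<Rightarrow> 'v) \<Rightarrow> bool" where
  "edge_vectors N l B E \<longleftrightarrow>
     (\<forall>j\<in>sink_idx N. \<forall>e\<in>in_arcs (dig N) (bd N j).
        E e = ((-1) ^ int_num N l e * weight N e) *\<^sub>R B j) \<and>
     (\<forall>(e, a)\<in>vertex_equations N l. E e = (\<Sum>f\<in>arcs (dig N). a f *\<^sub>R E f))"

text \<open>
  The coefficient matrix, with rows indexed by a list of equations and columns by a list of
  unknowns, once all unknowns have been moved to the left-hand side.
\<close>

definition system_matrix :: "('e \<times> ('e \<Rightarrow> real)) list \<Rightarrow> 'e list \<Rightarrow> real mat" where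
  "system_matrix qs es =
     mat (length qs) (length es)
       (\<lambda>(r, c). of_bool (es ! c = fst (qs ! r)) - snd (qs ! r) (es ! c))"


section \<open>Conservative flows\<close>

definition conservative_flows :: "'e plabic_network \<Rightarrow> 'e set set" where
  "conservative_flows N =
     {C. C \<subseteq> arcs (dig N) \<and>
         (\<forall>e\<in>C. tail (dig N) e \<notin> bd_verts N \<and> head (dig N) e \<notin> bd_verts N) \<and>
         (\<forall>v\<in>internal_verts N.
            card (C \<inter> in_arcs (dig N) v) = card (C \<inter> out_arcs (dig N) v))}"

definition flow_weight :: "'e plabic_network \<Rightarrow> 'e set \<Rightarrow> real" where
  "flow_weight N C = (\<Prod>e\<in>C. weight N e)"

end

theory Submission
  imports Defs "HOL-Library.Z2"
begin

text \<open>
  In the expansion of \<open>det M\<close> over permutations \<open>p\<close> of the unknown edges, a term is nonzero only if \<open>p\<close>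
  sends each edge that it moves to an edge leaving its head. The moved edges then form a
  conservative flow, and every flow arises from exactly one \<open>p\<close>. A flow is drawn as a family of
  disjoint simple closed polygons, so a gauge ray, which starts on the boundary of the disk, crosses
  it an even number of times. It remains to see that \<open>sign p\<close> is \<open>(-1)\<close> to the power of the number of
  edges plus the total winding, which is a parity form of the theorem on turning tangents.

  For that, rotate \<open>l\<close> to the vertical and perturb it so that all vertices have distinct abscissae. Then
  \<open>sign p\<close> is the parity of the number of inversions with respect to the order of abscissae. For an
  ordered pair of edges \<open>(u, v)\<close>, count the endpoints at which \<open>v\<close> lies above \<open>u\<close>: this number
  \<open>Q u v\<close> is even for disjoint edges, while \<open>Q u (p u)\<close> is the winding number modulo 2. Summing \<open>Q u v\<close>
  over the pairs in which \<open>u\<close> starts to the left of \<open>v\<close>, once by pairs of edges and once by pairs of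
  an edge and a vertex, shows that the winding is congruent to the number of edges plus the
  number of inversions.
\<close>

section \<open>Parity of inversions\<close>

text \<open>Parities are computed in the field of two elements; with these rules the simplifier
  would turn ring operations into bitwise ones, and the laws for sums and products would no longer
  apply.\<close>

declare add_bit_eq_xor [simp del] mult_bit_eq_and [simp del] power_bit_unfold [simp del]

lemma bit_add_self [simp]: "x + x = 0" "x + (x + y) = y" for x y :: bit
  by (cases x; cases y; simp)+

text \<open>Off-diagonal terms occur in equal pairs and cancel modulo 2.\<close>

lemma sum_symmetric_bit:
  fixes g :: "'a \<Rightarrow> 'a \<Rightarrow> bit"
  assumes "finite S" "\<And>u v. u \<in> S \<Longrightarrow> v \<in> S \<Longrightarrow> g u v = g v u" "\<And>u. u \<in> S \<Longrightarrow> g u u = 0"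
  shows "(\<Sum>u\<in>S. \<Sum>v\<in>S. g u v) = 0"
  using assms
proof (induction S rule: finite_induct)
  case (insert x S)
  have "(\<Sum>u\<in>S. g u x) = (\<Sum>v\<in>S. g x v)"
    using insert.prems by (intro sum.cong) auto
  with insert show ?case
    by (simp add: sum.distrib)
qed simp

text \<open>Outside \<open>{a, b}\<close> the sum is symmetric and vanishes. This isolates the pairs
  that a transposition of \<open>a\<close> and \<open>b\<close> can affect.\<close>

lemma sum_transpose_pair_bit:
  fixes g :: "'a \<Rightarrow> 'a \<Rightarrow> bit"
  assumes "finite S" "a \<in> S" "b \<in> S" "a \<noteq> b" "\<And>u. u \<in> S \<Longrightarrow> g u u = 0"
    and "\<And>u v. u \<in> S - {a, b} \<Longrightarrow> v \<in> S - {a, b} \<Longrightarrow> g u v = g v u"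
  shows "(\<Sum>u\<in>S. \<Sum>v\<in>S. g u v) =
    g a b + g b a + (\<Sum>w\<in>S - {a, b}. g a w + g w a + g b w + g w b)"
proof -
  define T where "T = S - {a, b}"
  have S: "S = insert a (insert b T)" and T: "finite T" "a \<notin> T" "b \<notin> T"
    using assms by (auto simp: T_def)
  have "(\<Sum>u\<in>T. \<Sum>v\<in>T. g u v) = 0"
    using assms by (intro sum_symmetric_bit) (auto simp: T_def)
  then show ?thesis
    using assms(4) assms(5)[of a] assms(5)[of b] T
    unfolding T_def[symmetric] by (simp add: S sum.distrib ac_simps)
qed

text \<open>The number of inversions modulo 2. For a tournament \<open>L\<close> exactly one of the
  pairs \<open>(u, v)\<close> and \<open>(v, u)\<close> with \<open>u\<close> and \<open>v\<close>
  distinct has \<open>L\<close> equal to 1, so each reversed pair is counted once.\<close>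

definition inversion_parity :: "'a set \<Rightarrow> ('a \<Rightarrow> 'a \<Rightarrow> bit) \<Rightarrow> ('a \<Rightarrow> 'a) \<Rightarrow> bit" where
  "inversion_parity S L p = (\<Sum>u\<in>S. \<Sum>v\<in>S. L u v * L (p v) (p u))"

text \<open>A strict comparison is stored with values in \<open>bit\<close>, so that reversing a
  pair means adding 1 and products express conjunction.\<close>

locale bit_tournament =
  fixes S :: "'a set" and L :: "'a \<Rightarrow> 'a \<Rightarrow> bit"
  assumes fin: "finite S"
    and irrefl [simp]: "\<And>u. L u u = 0"
    and total: "\<And>u v. u \<in> S \<Longrightarrow> v \<in> S \<Longrightarrow> u \<noteq> v \<Longrightarrow> L v u = 1 + L u v"
begin

lemma sum_L_permute2:
  assumes "p permutes S"
  shows "(\<Sum>u\<in>S. \<Sum>v\<in>S. h u (p v)) = (\<Sum>u\<in>S. \<Sum>v\<in>S. h u v)"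
proof (rule sum.cong[OF refl])
  show "(\<Sum>v\<in>S. h u (p v)) = (\<Sum>v\<in>S. h u v)" for u
    using sum.permute[OF assms, of "h u"] by (simp add: o_def)
qed

text \<open>The pair of values \<open>a\<close>, \<open>b\<close> changes its order. For any other
  value \<open>w\<close>, the pairs of \<open>w\<close> with \<open>a\<close> and of
  \<open>w\<close> with \<open>b\<close> contribute the same change, which cancels modulo 2.\<close>

lemma inversion_parity_transpose:
  assumes "p permutes S" "a \<in> S" "b \<in> S" "a \<noteq> b"
  shows "inversion_parity S L (Transposition.transpose a b \<circ> p) = inversion_parity S L p + 1"
proof -
  let ?t = "Transposition.transpose a b"
  let ?q = "inv_into UNIV p"
  have q: "?q permutes S" by (rule permutes_inv[OF assms(1)])
  have pq: "p (?q x) = x" "?q (p x) = x" for x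
    using permutes_inverses[OF assms(1)] by auto
  have qS: "?q x \<in> S \<longleftrightarrow> x \<in> S" for x using permutes_in_image[OF q] .
  \<comment> \<open>Summing over the values of \<open>p\<close> instead of its arguments lets
    \<open>r\<close> act on the summation variables themselves.\<close>
  have *: "inversion_parity S L (r \<circ> p) = (\<Sum>u\<in>S. \<Sum>v\<in>S. L (?q u) (?q v) * L (r v) (r u))" for r
  proof -
    have "inversion_parity S L (r \<circ> p) = (\<Sum>u\<in>S. \<Sum>v\<in>S. L u v * L (r (p v)) (r (p u)))"
      by (simp add: inversion_parity_def)
    also have "\<dots> = (\<Sum>u\<in>S. \<Sum>v\<in>S. L (?q u) (?q v) * L (r v) (r u))"
      using sum.permute[OF q, of "\<lambda>u. \<Sum>v\<in>S. L u v * L (r (p v)) (r (p u))"]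
        sum.permute[OF q, of "\<lambda>v. L u v * L (r (p v)) (r (p u))" for u]
      by (simp add: o_def pq)
    finally show ?thesis .
  qed
  have qne: "?q u \<noteq> ?q v" if "u \<noteq> v" for u v using that pq by metis
  \<comment> \<open>\<open>?g\<close> adds the summands before and after the transposition; it
    vanishes on pairs that avoid both \<open>a\<close> and \<open>b\<close>.\<close>
  let ?g = "\<lambda>u v. L (?q u) (?q v) * (L (?t v) (?t u) + L v u)"
  have "inversion_parity S L (?t \<circ> p) + inversion_parity S L (id \<circ> p) = (\<Sum>u\<in>S. \<Sum>v\<in>S. ?g u v)"
    unfolding * by (simp add: sum.distrib distrib_left)
  also have "\<dots> = ?g a b + ?g b a + (\<Sum>w\<in>S - {a, b}. ?g a w + ?g w a + ?g b w + ?g w b)"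
    using assms fin by (intro sum_transpose_pair_bit) auto
  also have "(\<Sum>w\<in>S - {a, b}. ?g a w + ?g w a + ?g b w + ?g w b) = 0"
  proof (intro sum.neutral ballI)
    fix w assume w: "w \<in> S - {a, b}"
    have 1: "L (?q w) (?q a) = 1 + L (?q a) (?q w)" "L (?q w) (?q b) = 1 + L (?q b) (?q w)"
      using w assms qne by (auto intro!: total simp: qS)
    have 2: "L w a = 1 + L a w" "L w b = 1 + L b w"
      using w assms by (auto intro!: total)
    from w show "?g a w + ?g w a + ?g b w + ?g w b = 0"
      by (cases "L a w"; cases "L b w") (auto simp: 1 2 algebra_simps)
  qed
  also have "?g a b + ?g b a = 1"
  proof -
    have "L (?q b) (?q a) = 1 + L (?q a) (?q b)" "L b a = 1 + L a b"
      using assms qne by (auto intro!: total simp: qS)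
    then show ?thesis by (cases "L a b") auto
  qed
  finally have "inversion_parity S L (?t \<circ> p) + inversion_parity S L p = 1"
    by (simp only: id_o add_0_right)
  then show ?thesis by (cases "inversion_parity S L (?t \<circ> p)"; cases "inversion_parity S L p") auto
qed

text \<open>A permutation is built up from transpositions, each of which changes both the sign and
  the parity.\<close>

lemma sign_eq_inversion_parity:
  assumes "p permutes S"
  shows "sign p = (if inversion_parity S L p = 0 then 1 else - 1)"
  using assms fin
proof (induction rule: permutes_induct)
  case id
  have "L u v * L v u = 0" if "u \<in> S" "v \<in> S" for u v
    using total[OF that] by (cases "u = v"; cases "L u v") auto
  then have "(\<Sum>u\<in>S. \<Sum>v\<in>S. L u v * L v u) = 0"
    by (intro sum.neutral ballI) blast
  then show ?case by (simp add: inversion_parity_def)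
next
  case (swap a b p)
  have *: "sign (Transposition.transpose a b \<circ> p) = - sign p"
    using sign_compose[OF permutation_swap_id permutes_imp_permutation[OF fin swap.hyps(4)], of a b] swap.hyps(3)
    by (simp add: sign_swap_id)
  show ?case
    unfolding * inversion_parity_transpose[OF swap.hyps(4,1,2,3)] swap.IH
    by (cases "inversion_parity S L p") simp_all
qed

text \<open>After exchanging \<open>u\<close> and \<open>v\<close> in the first term, a generic pair
  contributes \<open>1 + L v u + L u (p v)\<close>, because
  \<open>(1 + x) * (1 + y) + x * y = 1 + x + y\<close> modulo 2. The two sums of \<open>L\<close>
  agree after reindexing, so only the constant survives.\<close>

lemma sum_pair_diff_bit:
  assumes p: "p permutes S" and p_neq: "\<And>u. u \<in> S \<Longrightarrow> p u \<noteq> u"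
  shows "(\<Sum>u\<in>S. \<Sum>v\<in>S. L v u * L (p u) v + L v u * L u (p v)) = of_nat (card S)"
proof -
  \<comment> \<open>The two conditional terms correct the generic formula where \<open>u = v\<close>
    or \<open>u = p v\<close>; their totals are equal and cancel.\<close>
  let ?c = "\<lambda>u v. 1 + L v u + L u (p v) + (if u = v then 1 + L v (p v) else 0)
                     + (if u = p v then 1 + L v (p v) else 0)"
  have pS: "p x \<in> S \<longleftrightarrow> x \<in> S" for x by (rule permutes_in_image[OF p])
  have "(\<Sum>u\<in>S. \<Sum>v\<in>S. L v u * L (p u) v + L v u * L u (p v))
      = (\<Sum>u\<in>S. \<Sum>v\<in>S. L u v * L (p v) u + L v u * L u (p v))"
    unfolding sum.distrib by (subst sum.swap) (rule refl)
  also have "\<dots> = (\<Sum>u\<in>S. \<Sum>v\<in>S. ?c u v)"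
  proof (intro sum.cong refl)
    fix u v assume uv: "u \<in> S" "v \<in> S"
    have 1: "u \<noteq> v \<Longrightarrow> L v u = 1 + L u v" using total[of u v] uv by blast
    have 2: "u \<noteq> p v \<Longrightarrow> L (p v) u = 1 + L u (p v)" using total[of u "p v"] uv pS by blast
    show "L u v * L (p v) u + L v u * L u (p v) = ?c u v"
    proof (cases "u = v")
      case True
      then show ?thesis using p_neq[OF uv(1)] by (auto simp: ac_simps)
    next
      case False
      show ?thesis
      proof (cases "u = p v")
        case True
        with False 1 show ?thesis by (cases "L u v") auto
      next
        case False
        then show ?thesis using 2 1 \<open>u \<noteq> v\<close> by (cases "L u v"; cases "L u (p v)") auto
      qed
    qed
  qed
  also have "\<dots> = (\<Sum>u\<in>S. \<Sum>v\<in>S. 1) + ((\<Sum>u\<in>S. \<Sum>v\<in>S. L v u) + (\<Sum>u\<in>S. \<Sum>v\<in>S. L u (p v)))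
       + ((\<Sum>u\<in>S. \<Sum>v\<in>S. if u = v then 1 + L v (p v) else 0)
        + (\<Sum>u\<in>S. \<Sum>v\<in>S. if u = p v then 1 + L v (p v) else 0))"
    by (simp only: sum.distrib ac_simps)
  also have "(\<Sum>u\<in>S. \<Sum>v\<in>S. L u (p v)) = (\<Sum>u\<in>S. \<Sum>v\<in>S. L v u)"
    unfolding sum_L_permute2[OF p] by (rule sum.swap)
  also have "(\<Sum>u\<in>S. \<Sum>v\<in>S. if u = v then 1 + L v (p v) else 0) = (\<Sum>v\<in>S. 1 + L v (p v))"
    using fin by (subst sum.swap) (simp add: sum.delta)
  also have "(\<Sum>u\<in>S. \<Sum>v\<in>S. if u = p v then 1 + L v (p v) else 0) = (\<Sum>v\<in>S. 1 + L v (p v))"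
    using fin by (subst sum.swap) (simp add: sum.delta pS)
  \<comment> \<open>Every element of \<open>bit\<close> is its own square, in particular the
    cardinality modulo 2.\<close>
  also have "(\<Sum>u\<in>S. \<Sum>v\<in>S. 1) = (of_nat (card S) :: bit)"
    by (cases "of_nat (card S) :: bit") auto
  finally show ?thesis by simp
qed

end

section \<open>Double counting along directed cycles\<close>

text \<open>
  An element \<open>u\<close> stands both for the edge from \<open>u\<close> to \<open>p u\<close> and for its tail. \<open>B u v\<close> says that \<open>v\<close>
  lies strictly between the ends of the edge \<open>u\<close>, and \<open>D u v\<close> that in addition it lies above that edge;
  thus \<open>B u v + D u v\<close> says that it lies below.
\<close>

locale bit_diagram = bit_tournament S L for S :: "'a set" and L +
  fixes p :: "'a \<Rightarrow> 'a" and D B :: "'a \<Rightarrow> 'a \<Rightarrow> bit"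
  assumes perm: "p permutes S"
    and p_neq: "\<And>u. u \<in> S \<Longrightarrow> p u \<noteq> u"
    and pp_neq: "\<And>u. u \<in> S \<Longrightarrow> p (p u) \<noteq> u"
    and D_ends [simp]: "\<And>u. u \<in> S \<Longrightarrow> D u u = 0" "\<And>u. u \<in> S \<Longrightarrow> D u (p u) = 0"
    and B_ends [simp]: "\<And>u. u \<in> S \<Longrightarrow> B u u = 0" "\<And>u. u \<in> S \<Longrightarrow> B u (p u) = 0"
    and B_eq: "\<And>u v. \<lbrakk>u \<in> S; v \<in> S; v \<noteq> u; v \<noteq> p u\<rbrakk> \<Longrightarrow> B u v = L u v + L (p u) v"
begin

text \<open>The first two summands are the ends of \<open>v\<close> above the edge \<open>u\<close>;
  the bracketed ones are the ends of \<open>u\<close> below the edge \<open>v\<close>.\<close>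

definition Q :: "'a \<Rightarrow> 'a \<Rightarrow> bit" where
  "Q u v = D u v + D u (p v) + (B v u + D v u) + (B v (p u) + D v (p u))"

lemma pS [simp]: "p x \<in> S \<longleftrightarrow> x \<in> S"
  by (rule permutes_in_image[OF perm])

lemma inj_p: "p x = p y \<longleftrightarrow> x = y"
  using permutes_inj[OF perm] by (auto dest: injD)

text \<open>Exchanging the two edges turns "above" into "below", so the values differ by betweenness
  terms alone. At the shared vertex \<open>p u\<close> these vanish, and \<open>B_eq\<close>
  expresses the other two through \<open>L\<close>.\<close>

lemma Q_adjacent:
  assumes "u \<in> S"
  shows "Q (p u) u = Q u (p u) + L u (p u) + L (p u) (p (p u))"
proof -
  have n: "p (p u) \<noteq> u" "p u \<noteq> u" using assms p_neq pp_neq by auto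
  have "Q (p u) u = Q u (p u) + (B u (p (p u)) + B (p u) u)"
    using assms unfolding Q_def by (simp add: ac_simps)
  also have "B u (p (p u)) = L u (p (p u)) + L (p u) (p (p u))"
    using assms n by (intro B_eq) (auto simp: inj_p)
  also have "B (p u) u = L (p u) u + L (p (p u)) u"
    using assms n by (intro B_eq) auto
  also have "L (p u) u = 1 + L u (p u)" using total[of u "p u"] assms n by fastforce
  also have "L (p (p u)) u = 1 + L u (p (p u))" using total[of u "p (p u)"] assms n by fastforce
  finally show ?thesis by (simp add: ac_simps)
qed

text \<open>This counts by pairs of edges: only consecutive edges contribute, in whichever order
  \<open>L\<close> selects, and \<open>Q_adjacent\<close> reduces the second order to
  \<open>Q u (p u)\<close>.\<close>

lemma sum_LQ_adjacent:
  assumes Q0: "\<And>u v. \<lbrakk>u \<in> S; v \<in> S; u \<noteq> v; v \<noteq> p u; u \<noteq> p v\<rbrakk> \<Longrightarrow> Q u v = 0"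
  shows "(\<Sum>u\<in>S. \<Sum>v\<in>S. L u v * Q u v) =
    (\<Sum>u\<in>S. Q u (p u)) + (\<Sum>u\<in>S. L u (p u) + L u (p u) * L (p u) (p (p u)))"
proof -
  \<comment> \<open>The cases \<open>v = p u\<close> and \<open>u = p v\<close> exclude each other
    by \<open>pp_neq\<close>.\<close>
  have "(\<Sum>u\<in>S. \<Sum>v\<in>S. L u v * Q u v) = (\<Sum>u\<in>S. \<Sum>v\<in>S.
     (if v = p u then L u (p u) * Q u (p u) else 0) + (if u = p v then L (p v) v * Q (p v) v else 0))"
  proof (intro sum.cong refl)
    fix u v assume "u \<in> S" "v \<in> S"
    then show "L u v * Q u v = (if v = p u then L u (p u) * Q u (p u) else 0)
        + (if u = p v then L (p v) v * Q (p v) v else 0)"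
      using Q0[of u v] pp_neq[of u] pp_neq[of v] by (cases "u = v") auto
  qed
  also have "\<dots> = (\<Sum>u\<in>S. L u (p u) * Q u (p u)) + (\<Sum>v\<in>S. L (p v) v * Q (p v) v)"
    unfolding sum.distrib
    by (subst (2) sum.swap) (simp add: fin)
  also have "\<dots> = (\<Sum>u\<in>S. Q u (p u) + (L (p u) (p (p u)) + L u (p u) * L (p u) (p (p u))))"
    unfolding sum.distrib[symmetric]
  proof (intro sum.cong refl)
    fix u assume u: "u \<in> S"
    have 1: "L (p u) u = 1 + L u (p u)" using total[of u "p u"] p_neq[of u] u by fastforce
    show "L u (p u) * Q u (p u) + L (p u) u * Q (p u) u =
      Q u (p u) + (L (p u) (p (p u)) + L u (p u) * L (p u) (p (p u)))"
      unfolding Q_adjacent[OF u] 1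
      by (cases "L u (p u)"; cases "L (p u) (p (p u))"; cases "Q u (p u)") auto
  qed
  also have "\<dots> = (\<Sum>u\<in>S. Q u (p u)) + ((\<Sum>u\<in>S. L (p u) (p (p u)))
      + (\<Sum>u\<in>S. L u (p u) * L (p u) (p (p u))))"
    by (simp only: sum.distrib)
  also have "(\<Sum>u\<in>S. L (p u) (p (p u))) = (\<Sum>u\<in>S. L u (p u))"
    using sum.permute[OF perm, of "\<lambda>u. L u (p u)"] by (simp add: o_def)
  finally show ?thesis by (simp only: sum.distrib)
qed

text \<open>Off the diagonal \<open>L u v + L v u = 1\<close>.\<close>

lemma sum_L_eq_all:
  assumes "\<And>u. u \<in> S \<Longrightarrow> h u u = 0"
  shows "(\<Sum>u\<in>S. \<Sum>v\<in>S. L u v * h u v + L v u * h u v) = (\<Sum>u\<in>S. \<Sum>v\<in>S. h u v)"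
proof (intro sum.cong refl)
  fix u v assume "u \<in> S" "v \<in> S"
  then show "L u v * h u v + L v u * h u v = h u v"
    using total[of u v] assms[of u] by (cases "u = v"; cases "L u v") auto
qed

text \<open>This counts by pairs of an edge and a vertex. Each \<open>D\<close> sum occurs once with
  \<open>L u v\<close> and once with \<open>L v u\<close>, so \<open>L\<close> disappears from it,
  and the two resulting totals agree after reindexing by \<open>p\<close>. What remains are
  betweenness terms, which \<open>B_eq\<close> turns into products of values of
  \<open>L\<close>.\<close>

lemma sum_LQ_reindex:
  "(\<Sum>u\<in>S. \<Sum>v\<in>S. L u v * Q u v) = of_nat (card S) + inversion_parity S L p
     + (\<Sum>u\<in>S. L u (p u) + L u (p u) * L (p u) (p (p u)))"
proof -
  have "(\<Sum>u\<in>S. \<Sum>v\<in>S. L u v * Q u v) =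
     ((\<Sum>u\<in>S. \<Sum>v\<in>S. L u v * D u v) + (\<Sum>u\<in>S. \<Sum>v\<in>S. L u v * D v u))
   + ((\<Sum>u\<in>S. \<Sum>v\<in>S. L u v * D u (p v)) + (\<Sum>u\<in>S. \<Sum>v\<in>S. L u v * D v (p u)))
   + ((\<Sum>u\<in>S. \<Sum>v\<in>S. L u v * B v u) + (\<Sum>u\<in>S. \<Sum>v\<in>S. L u v * B v (p u)))"
    unfolding Q_def by (simp only: sum.distrib distrib_left ac_simps)
  also have "(\<Sum>u\<in>S. \<Sum>v\<in>S. L u v * D v u) = (\<Sum>u\<in>S. \<Sum>v\<in>S. L v u * D u v)"
    by (rule sum.swap)
  also have "(\<Sum>u\<in>S. \<Sum>v\<in>S. L u v * D v (p u)) = (\<Sum>u\<in>S. \<Sum>v\<in>S. L v u * D u (p v))"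
    by (rule sum.swap)
  also have "(\<Sum>u\<in>S. \<Sum>v\<in>S. L u v * B v u) = (\<Sum>u\<in>S. \<Sum>v\<in>S. L v u * B u v)"
    by (rule sum.swap)
  also have "(\<Sum>u\<in>S. \<Sum>v\<in>S. L u v * B v (p u)) = (\<Sum>u\<in>S. \<Sum>v\<in>S. L v u * B u (p v))"
    by (rule sum.swap)
  also have "(\<Sum>u\<in>S. \<Sum>v\<in>S. L u v * D u v) + (\<Sum>u\<in>S. \<Sum>v\<in>S. L v u * D u v) = (\<Sum>u\<in>S. \<Sum>v\<in>S. D u v)"
    unfolding sum.distrib[symmetric] by (rule sum_L_eq_all) simp
  also have "(\<Sum>u\<in>S. \<Sum>v\<in>S. L u v * D u (p v)) + (\<Sum>u\<in>S. \<Sum>v\<in>S. L v u * D u (p v)) = (\<Sum>u\<in>S. \<Sum>v\<in>S. D u (p v))"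
    unfolding sum.distrib[symmetric] by (rule sum_L_eq_all) simp
  also have "\<dots> = (\<Sum>u\<in>S. \<Sum>v\<in>S. D u v)" by (rule sum_L_permute2[OF perm])
  also have "(\<Sum>u\<in>S. \<Sum>v\<in>S. L v u * B u v) = (\<Sum>u\<in>S. \<Sum>v\<in>S. L v u * L (p u) v)"
  proof (intro sum.cong refl)
    fix u v assume uv: "u \<in> S" "v \<in> S"
    show "L v u * B u v = L v u * L (p u) v"
      using uv B_eq[of u v] total[of u v]
      by (cases "v = u"; cases "v = p u"; cases "L u v") auto
  qed
  \<comment> \<open>For \<open>u = p v\<close> the vertex tested is an end of the edge, so
    \<open>B\<close> vanishes there; the conditional summand cancels what the formula of
    \<open>B_eq\<close> would give.\<close>
  also have "(\<Sum>u\<in>S. \<Sum>v\<in>S. L v u * B u (p v)) = (\<Sum>u\<in>S. \<Sum>v\<in>S.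
      (L v u * L u (p v) + L v u * L (p u) (p v)) + (if u = p v then L v (p v) * (1 + L (p v) (p (p v))) else 0))"
  proof (intro sum.cong refl)
    fix u v assume uv: "u \<in> S" "v \<in> S"
    show "L v u * B u (p v) = (L v u * L u (p v) + L v u * L (p u) (p v))
        + (if u = p v then L v (p v) * (1 + L (p v) (p (p v))) else 0)"
    proof (cases "u = v")
      case True
      with uv show ?thesis using p_neq[of v] by auto
    next
      case False
      show ?thesis
      proof (cases "u = p v")
        case True
        then show ?thesis using uv total[of "p v" "p (p v)"] p_neq[of "p v"]
          by (cases "L v (p v)"; cases "L (p v) (p (p v))") auto
      next
        case F: False
        have "B u (p v) = L u (p v) + L (p u) (p v)"
          using uv F False by (intro B_eq) (auto simp: inj_p)
        with F show ?thesis by (simp add: distrib_left)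
      qed
    qed
  qed
  also have "\<dots> = (\<Sum>u\<in>S. \<Sum>v\<in>S. L v u * L u (p v)) + (\<Sum>u\<in>S. \<Sum>v\<in>S. L v u * L (p u) (p v))
     + (\<Sum>u\<in>S. \<Sum>v\<in>S. (if u = p v then L v (p v) * (1 + L (p v) (p (p v))) else 0))"
    unfolding sum.distrib ..
  also have "(\<Sum>u\<in>S. \<Sum>v\<in>S. (if u = p v then L v (p v) * (1 + L (p v) (p (p v))) else 0))
     = (\<Sum>v\<in>S. L v (p v) + L v (p v) * L (p v) (p (p v)))"
    by (subst sum.swap) (simp add: fin distrib_left)
  also have "(\<Sum>u\<in>S. \<Sum>v\<in>S. L v u * L (p u) (p v)) = inversion_parity S L p"
    unfolding inversion_parity_def by (rule sum.swap)
  finally have "(\<Sum>u\<in>S. \<Sum>v\<in>S. L u v * Q u v) =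
     ((\<Sum>u\<in>S. \<Sum>v\<in>S. L v u * L (p u) v) + (\<Sum>u\<in>S. \<Sum>v\<in>S. L v u * L u (p v))) + inversion_parity S L p
     + (\<Sum>v\<in>S. L v (p v) + L v (p v) * L (p v) (p (p v)))"
    by (simp add: ac_simps)
  then show ?thesis
    unfolding sum.distrib[symmetric] using sum_pair_diff_bit[OF perm p_neq] by (simp only: sum.distrib)
qed

text \<open>The two counts leave the same remainder in \<open>L\<close>, which cancels.\<close>

theorem sum_Q_successor:
  assumes "\<And>u v. \<lbrakk>u \<in> S; v \<in> S; u \<noteq> v; v \<noteq> p u; u \<noteq> p v\<rbrakk> \<Longrightarrow> Q u v = 0"
  shows "(\<Sum>u\<in>S. Q u (p u)) = of_nat (card S) + inversion_parity S L p"
  using sum_LQ_adjacent[OF assms] sum_LQ_reindex by simp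

end

section \<open>The turning of closed polygons\<close>

definition line_height :: "complex \<Rightarrow> complex \<Rightarrow> real \<Rightarrow> real" where
  "line_height a b x = Im a + (x - Re a) * (Im b - Im a) / (Re b - Re a)"

definition strictly_between :: "real \<Rightarrow> real \<Rightarrow> real \<Rightarrow> bool" where
  "strictly_between x y z \<longleftrightarrow> x < z \<and> z < y \<or> y < z \<and> z < x"

definition above_segment :: "complex \<Rightarrow> complex \<Rightarrow> complex \<Rightarrow> bool" where
  "above_segment a b z \<longleftrightarrow>
     strictly_between (Re a) (Re b) (Re z) \<and> line_height a b (Re z) < Im z"

lemma strictly_between_commute: "strictly_between x y z = strictly_between y x z"
  by (auto simp: strictly_between_def)

lemma strictly_between_ends [simp]: "\<not> strictly_between x y x" "\<not> strictly_between x y y"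
  by (auto simp: strictly_between_def)

lemma line_height_commute:
  assumes "Re a \<noteq> Re b"
  shows "line_height a b x = line_height b a x"
  using assms by (simp add: line_height_def divide_simps) (simp add: algebra_simps)

lemma above_segment_commute:
  assumes "Re a \<noteq> Re b"
  shows "above_segment a b z = above_segment b a z"
  using line_height_commute[OF assms] strictly_between_commute by (auto simp: above_segment_def)

lemma line_height_ends [simp]:
  "line_height a b (Re a) = Im a" "Re a \<noteq> Re b \<Longrightarrow> line_height a b (Re b) = Im b"
  by (auto simp: line_height_def)

lemma on_closed_segment_if_line_height:
  assumes "Re a < Re b" "Re a \<le> x" "x \<le> Re b"
  shows "Complex x (line_height a b x) \<in> closed_segment a b"
proof -
  define t where "t = (x - Re a) / (Re b - Re a)"
  have "0 \<le> t" "t \<le> 1" using assms by (auto simp: t_def)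
  moreover have "Complex x (line_height a b x) = a + t *\<^sub>R (b - a)"
    using assms by (auto simp: complex_eq_iff t_def line_height_def)
  ultimately show ?thesis
    by (auto simp: closed_segment_def algebra_simps intro!: exI[of _ t])
qed

text \<open>On the common range of abscissae the difference of the heights has no zero and thus, by
  the intermediate value theorem, constant sign. Both limits of that range are abscissae of
  endpoints, so the endpoints at which the second segment lies above the first number zero or
  two.\<close>

lemma segments_alternate_aux:
  assumes ab: "Re a < Re b" and cd: "Re c < Re d"
    and ne: "Re a \<noteq> Re c" "Re a \<noteq> Re d" "Re b \<noteq> Re c" "Re b \<noteq> Re d"
    and disj: "closed_segment a b \<inter> closed_segment c d = {}"
  shows "of_bool (above_segment a b c) + of_bool (above_segment a b d)
    + (of_bool (strictly_between (Re c) (Re d) (Re a)) + of_bool (above_segment c d a))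
    + (of_bool (strictly_between (Re c) (Re d) (Re b)) + of_bool (above_segment c d b)) = (0 :: bit)"
proof -
  define f where "f x = line_height c d x - line_height a b x" for x
  define lo where "lo = max (Re a) (Re c)"
  define hi where "hi = min (Re b) (Re d)"
  have cont: "continuous_on A f" for A
    using ab cd unfolding f_def line_height_def by (intro continuous_intros) auto
  have nz: "f x \<noteq> 0" if "lo \<le> x" "x \<le> hi" for x
  proof
    assume "f x = 0"
    then have "Complex x (line_height a b x) \<in> closed_segment a b \<inter> closed_segment c d"
      using on_closed_segment_if_line_height[OF ab, of x] on_closed_segment_if_line_height[OF cd, of x] that
      by (auto simp: f_def lo_def hi_def)
    with disj show False by auto
  qed
  have same: "f lo > 0 \<longleftrightarrow> f hi > 0" if "lo < hi"
  proof (rule iffI)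
    assume "f lo > 0"
    show "f hi > 0"
    proof (rule ccontr)
      assume "\<not> f hi > 0"
      with \<open>f lo > 0\<close> that cont have "\<exists>x. lo \<le> x \<and> x \<le> hi \<and> f x = 0"
        by (intro IVT2') auto
      with nz show False by blast
    qed
  next
    assume "f hi > 0"
    show "f lo > 0"
    proof (rule ccontr)
      assume "\<not> f lo > 0"
      with \<open>f hi > 0\<close> that cont have "\<exists>x. lo \<le> x \<and> x \<le> hi \<and> f x = 0"
        by (intro IVT') auto
      with nz show False by blast
    qed
  qed
  have fc: "above_segment a b c \<longleftrightarrow> strictly_between (Re a) (Re b) (Re c) \<and> f (Re c) > 0"
    and fd: "above_segment a b d \<longleftrightarrow> strictly_between (Re a) (Re b) (Re d) \<and> f (Re d) > 0"
    and fa: "above_segment c d a \<longleftrightarrow> strictly_between (Re c) (Re d) (Re a) \<and> f (Re a) < 0"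
    and fb: "above_segment c d b \<longleftrightarrow> strictly_between (Re c) (Re d) (Re b) \<and> f (Re b) < 0"
    using ab cd by (auto simp: above_segment_def f_def)
  show ?thesis
  proof (cases "lo < hi")
    case False
    then show ?thesis using ab cd ne
      by (auto simp: fa fb fc fd strictly_between_def lo_def hi_def)
  next
    case True
    have s: "f lo < 0 \<longleftrightarrow> \<not> f lo > 0" "f hi < 0 \<longleftrightarrow> \<not> f lo > 0" "f hi > 0 \<longleftrightarrow> f lo > 0"
      using same[OF True] nz[of lo] nz[of hi] True by auto
    consider "lo = Re a" "Re c < Re a" | "lo = Re c" "Re a < Re c" using ne by (fastforce simp: lo_def)
    then show ?thesis
    proof cases
      case 1
      consider "hi = Re b" "Re b < Re d" | "hi = Re d" "Re d < Re b" using ne by (fastforce simp: hi_def)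
      then show ?thesis
        using 1 True s ab cd by cases (auto simp: fa fb fc fd strictly_between_def)
    next
      case 2
      consider "hi = Re b" "Re b < Re d" | "hi = Re d" "Re d < Re b" using ne by (fastforce simp: hi_def)
      then show ?thesis
        using 2 True s ab cd by cases (auto simp: fa fb fc fd strictly_between_def)
    qed
  qed
qed

text \<open>The expression is symmetric under exchanging the ends of either segment, so both may be
  directed to the right.\<close>

lemma segments_alternate:
  assumes "Re a \<noteq> Re b" and "Re c \<noteq> Re d"
    and ne: "Re a \<noteq> Re c" "Re a \<noteq> Re d" "Re b \<noteq> Re c" "Re b \<noteq> Re d"
    and disj: "closed_segment a b \<inter> closed_segment c d = {}"
  shows "of_bool (above_segment a b c) + of_bool (above_segment a b d)
    + (of_bool (strictly_between (Re c) (Re d) (Re a)) + of_bool (above_segment c d a))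
    + (of_bool (strictly_between (Re c) (Re d) (Re b)) + of_bool (above_segment c d b)) = (0 :: bit)"
proof -
  note comm = above_segment_commute[OF assms(1)] above_segment_commute[OF assms(2)]
    strictly_between_commute[of "Re c" "Re d"]
  consider "Re a < Re b" "Re c < Re d" | "Re a < Re b" "Re d < Re c"
    | "Re b < Re a" "Re c < Re d" | "Re b < Re a" "Re d < Re c"
    using assms by linarith
  then show ?thesis
  proof cases
    case 1
    with segments_alternate_aux[of a b c d] ne disj show ?thesis by simp
  next
    case 2
    with segments_alternate_aux[of a b d c] ne disj show ?thesis
      by (simp add: comm closed_segment_commute ac_simps)
  next
    case 3
    with segments_alternate_aux[of b a c d] ne disj show ?thesis
      by (simp add: comm closed_segment_commute ac_simps)
  next
    case 4
    with segments_alternate_aux[of b a d c] ne disj show ?thesis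
      by (simp add: comm closed_segment_commute ac_simps)
  qed
qed

section \<open>Turning at a vertex with respect to the vertical\<close>

text \<open>The condition for the winding number of consecutive edges with directions \<open>a\<close>, \<open>b\<close> to be odd.\<close>

definition turns_through :: "complex \<Rightarrow> complex \<Rightarrow> complex \<Rightarrow> bool" where
  "turns_through l a b \<longleftrightarrow>
     orient a b = 1 \<and> orient a l = 1 \<and> orient l b = 1 \<or>
     orient a b = -1 \<and> orient a l = -1 \<and> orient l b = -1"

lemma turns_through_i:
  "turns_through \<i> a b \<longleftrightarrow>
     0 < Re a \<and> Re b < 0 \<and> 0 < Re a * Im b - Im a * Re b \<or>
     Re a < 0 \<and> 0 < Re b \<and> Re a * Im b - Im a * Re b < 0"
  by (auto simp: turns_through_def orient_def sgn_1_pos sgn_1_neg)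

text \<open>The right-hand side is what remains of \<open>Q\<close> for consecutive edges. If
  \<open>b\<close> has the middle abscissa, the path does not turn back and both sides vanish.
  Otherwise it turns through the upward direction exactly when the second edge lies above the first
  where they overlap.\<close>

lemma turns_through_i_eq_above:
  assumes ne: "Re a \<noteq> Re b" "Re a \<noteq> Re c" "Re b \<noteq> Re c"
    and inter: "closed_segment a b \<inter> closed_segment b c \<subseteq> {b}"
  shows "of_bool (turns_through \<i> (b - a) (c - b)) = of_bool (above_segment a b c)
    + (of_bool (strictly_between (Re b) (Re c) (Re a)) + (of_bool (above_segment b c a) :: bit))"
proof -
  \<comment> \<open>\<open>a\<close> does not lie on the second edge, so between its ends and not
    above it means strictly below.\<close>
  have ht: "line_height b c (Re a) \<noteq> Im a" if "strictly_between (Re b) (Re c) (Re a)"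
  proof
    assume eq: "line_height b c (Re a) = Im a"
    have "Complex (Re a) (line_height b c (Re a)) \<in> closed_segment b c"
    proof (cases "Re b < Re c")
      case True
      then show ?thesis using that by (intro on_closed_segment_if_line_height) (auto simp: strictly_between_def)
    next
      case False
      then have "Complex (Re a) (line_height c b (Re a)) \<in> closed_segment c b"
        using that by (intro on_closed_segment_if_line_height) (auto simp: strictly_between_def)
      then show ?thesis using line_height_commute[of b c] ne by (simp add: closed_segment_commute)
    qed
    then have "a \<in> closed_segment b c" using eq by (simp add: complex.expand)
    then have "a \<in> {b}" using inter by auto
    with ne show False by simp
  qed
  consider "strictly_between (Re a) (Re b) (Re c)" | "strictly_between (Re b) (Re c) (Re a)"
    | "strictly_between (Re a) (Re c) (Re b)"
    using ne unfolding strictly_between_def by linarith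
  then show ?thesis
  proof cases
    case 1
    then have "\<not> strictly_between (Re b) (Re c) (Re a)" by (auto simp: strictly_between_def)
    moreover have "turns_through \<i> (b - a) (c - b) \<longleftrightarrow> line_height a b (Re c) < Im c"
      using 1 by (auto simp: turns_through_i strictly_between_def line_height_def field_simps)
    ultimately show ?thesis using 1 by (simp add: above_segment_def)
  next
    case 2
    then have "\<not> strictly_between (Re a) (Re b) (Re c)" by (auto simp: strictly_between_def)
    moreover have "turns_through \<i> (b - a) (c - b) \<longleftrightarrow> line_height b c (Re a) > Im a"
      using 2 by (auto simp: turns_through_i strictly_between_def line_height_def field_simps)
    ultimately show ?thesis using 2 ht by (auto simp add: above_segment_def)
  next
    case 3
    then have "\<not> strictly_between (Re a) (Re b) (Re c)" "\<not> strictly_between (Re b) (Re c) (Re a)"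
       "\<not> turns_through \<i> (b - a) (c - b)"
      by (auto simp: strictly_between_def turns_through_i)
    then show ?thesis by (simp add: above_segment_def)
  qed
qed

text \<open>The homomorphism from addition modulo 2 to multiplication of signs, by which a parity
  identity becomes a product formula.\<close>

definition bit_sign :: "bit \<Rightarrow> int" where
  "bit_sign x = (if x = 0 then 1 else - 1)"

lemma bit_sign_simps [simp]:
  "bit_sign 0 = 1" "bit_sign 1 = -1" "bit_sign (x + y) = bit_sign x * bit_sign y"
  by (cases x; cases y; simp add: bit_sign_def)+

lemma bit_sign_of_nat: "bit_sign (of_nat n) = (- 1) ^ n"
  by (induction n) simp_all

lemma bit_sign_sum: "bit_sign (\<Sum>u\<in>S. f u) = (\<Prod>u\<in>S. bit_sign (f u))"
  by (induction S rule: infinite_finite_induct) auto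

text \<open>The abscissae provide the tournament. Edges without a common vertex are disjoint and
  have \<open>Q\<close> equal to 0, while \<open>Q\<close> of consecutive edges detects turning; the
  double count then links turning to inversions.\<close>

lemma sign_closed_polygons_vertical:
  fixes Z :: "'a \<Rightarrow> complex"
  assumes fin: "finite S" and p: "p permutes S"
    and inj: "inj_on (\<lambda>u. Re (Z u)) S"
    and p_neq: "\<And>u. u \<in> S \<Longrightarrow> p u \<noteq> u" and pp_neq: "\<And>u. u \<in> S \<Longrightarrow> p (p u) \<noteq> u"
    and seg: "\<And>u v. \<lbrakk>u \<in> S; v \<in> S; u \<noteq> v\<rbrakk> \<Longrightarrow>
      closed_segment (Z u) (Z (p u)) \<inter> closed_segment (Z v) (Z (p v)) \<subseteq> {Z u, Z (p u)} \<inter> {Z v, Z (p v)}"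
  shows "sign p = (- 1) ^ card S *
    (\<Prod>u\<in>S. if turns_through \<i> (Z (p u) - Z u) (Z (p (p u)) - Z (p u)) then - 1 else 1)"
proof -
  define L where "L u v = (of_bool (Re (Z u) < Re (Z v)) :: bit)" for u v
  define D where "D u v = (of_bool (above_segment (Z u) (Z (p u)) (Z v)) :: bit)" for u v
  define B where "B u v = (of_bool (strictly_between (Re (Z u)) (Re (Z (p u))) (Re (Z v))) :: bit)" for u v
  have pS: "p x \<in> S \<longleftrightarrow> x \<in> S" for x
    by (rule permutes_in_image[OF p])
  have Xinj: "Re (Z u) \<noteq> Re (Z v)" if "u \<in> S" "v \<in> S" "u \<noteq> v" for u v
    using inj that by (auto dest: inj_onD)
  have pinj: "p u = p v \<longleftrightarrow> u = v" for u v
    using permutes_inj[OF p] by (auto dest: injD)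
  interpret bit_diagram S L p D B
  proof
    fix u v assume uv: "u \<in> S" "v \<in> S"
    show "u \<noteq> v \<Longrightarrow> L v u = 1 + L u v"
      using Xinj[OF uv] by (auto simp: L_def)
    show "B u v = L u v + L (p u) v" if "v \<noteq> u" "v \<noteq> p u"
      using Xinj[of u v] Xinj[of "p u" v] uv that pS
      by (auto simp: B_def L_def strictly_between_def)
  qed (use fin p p_neq pp_neq in \<open>auto simp: L_def B_def D_def above_segment_def\<close>)
  have zero: "Q u v = 0" if uv: "u \<in> S" "v \<in> S" "u \<noteq> v" "v \<noteq> p u" "u \<noteq> p v" for u v
  proof -
    have "p u \<noteq> p v" using pinj that by auto
    then have X: "Re (Z u) \<noteq> Re (Z v)" "Re (Z u) \<noteq> Re (Z (p v))" "Re (Z (p u)) \<noteq> Re (Z v)"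
      "Re (Z (p u)) \<noteq> Re (Z (p v))"
      using Xinj[of u v] Xinj[of u "p v"] Xinj[of "p u" v] Xinj[of "p u" "p v"] uv pS by auto
    then have "{Z u, Z (p u)} \<inter> {Z v, Z (p v)} = {}" by auto
    then have "closed_segment (Z u) (Z (p u)) \<inter> closed_segment (Z v) (Z (p v)) = {}"
      using seg[of u v] uv by blast
    moreover have "Re (Z u) \<noteq> Re (Z (p u))" "Re (Z v) \<noteq> Re (Z (p v))"
      using Xinj[of u "p u"] Xinj[of v "p v"] uv pS p_neq[of u] p_neq[of v] by auto
    ultimately show ?thesis
      using segments_alternate[of "Z u" "Z (p u)" "Z v" "Z (p v)"] X
      unfolding Q_def D_def B_def by blast
  qed
  have succ: "Q u (p u) = of_bool (turns_through \<i> (Z (p u) - Z u) (Z (p (p u)) - Z (p u)))"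
    if u: "u \<in> S" for u
  proof -
    have X: "Re (Z u) \<noteq> Re (Z (p u))" "Re (Z u) \<noteq> Re (Z (p (p u)))" "Re (Z (p u)) \<noteq> Re (Z (p (p u)))"
      using Xinj[of u "p u"] Xinj[of u "p (p u)"] Xinj[of "p u" "p (p u)"]
        u pS p_neq[of u] pp_neq[of u] p_neq[of "p u"] by auto
    have "closed_segment (Z u) (Z (p u)) \<inter> closed_segment (Z (p u)) (Z (p (p u))) \<subseteq>
      {Z u, Z (p u)} \<inter> {Z (p u), Z (p (p u))}"
      using u pS p_neq[of u] by (intro seg) auto
    also have "\<dots> \<subseteq> {Z (p u)}" using X by auto
    finally have sub: "closed_segment (Z u) (Z (p u)) \<inter> closed_segment (Z (p u)) (Z (p (p u))) \<subseteq> {Z (p u)}" .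
    have e: "D u (p u) = 0" "B (p u) (p u) = 0" "D (p u) (p u) = 0"
      using u by simp_all
    have "Q u (p u) = D u (p (p u)) + (B (p u) u + D (p u) u)"
      by (simp add: Q_def e)
    then show ?thesis
      using turns_through_i_eq_above[OF X sub] unfolding D_def B_def by simp
  qed
  let ?T = "\<lambda>u. turns_through \<i> (Z (p u) - Z u) (Z (p (p u)) - Z (p u))"
  have "inversion_parity S L p = of_nat (card S) + (\<Sum>u\<in>S. of_bool (?T u))"
    using sum_Q_successor[OF zero] succ by simp
  then have "bit_sign (inversion_parity S L p) = (- 1) ^ card S * (\<Prod>u\<in>S. bit_sign (of_bool (?T u)))"
    by (simp add: bit_sign_of_nat bit_sign_sum)
  also have "(\<Prod>u\<in>S. bit_sign (of_bool (?T u))) = (\<Prod>u\<in>S. if ?T u then -1 else 1)"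
    by (intro prod.cong) auto
  finally show ?thesis
    using sign_eq_inversion_parity[OF p] by (simp add: bit_sign_def)
qed

section \<open>Perturbing and rotating the reference direction\<close>

lemma eventually_rotate_nonreal:
  assumes "w \<noteq> 0"
  shows "\<forall>\<^sub>F \<epsilon> in at_right (0::real). Im (w * Complex 1 (- \<epsilon>)) \<noteq> 0 \<and>
     (Im w \<noteq> 0 \<longrightarrow> sgn (Im (w * Complex 1 (- \<epsilon>))) = sgn (Im w))"
proof -
  have lim: "((\<lambda>\<epsilon>. Im (w * Complex 1 (- \<epsilon>))) \<longlongrightarrow> Im w) (at_right 0)"
    by (auto intro!: tendsto_eq_intros)
  consider "Im w = 0" "Re w \<noteq> 0" | "Im w > 0" | "Im w < 0"
    using assms by (cases "Im w" "0 :: real" rule: linorder_cases) (auto simp: complex_eq_iff)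
  then show ?thesis
  proof cases
    \<comment> \<open>For real \<open>w\<close> the small rotation produces the imaginary part
      \<open>- \<epsilon> * Re w\<close>, which is nonzero.\<close>
    case 1
    have "\<forall>\<^sub>F \<epsilon> in at_right (0::real). \<epsilon> > 0" by (rule eventually_at_right_less)
    then show ?thesis by eventually_elim (use 1 in auto)
  next
    case 2
    have "\<forall>\<^sub>F \<epsilon> in at_right 0. Im (w * Complex 1 (- \<epsilon>)) > 0"
      by (rule order_tendstoD(1)[OF lim 2])
    then show ?thesis by eventually_elim (use 2 in \<open>auto simp del: times_complex.sel\<close>)
  next
    case 3
    have "\<forall>\<^sub>F \<epsilon> in at_right 0. Im (w * Complex 1 (- \<epsilon>)) < 0"
      by (rule order_tendstoD(2)[OF lim 3])
    then show ?thesis by eventually_elim (use 3 in \<open>auto simp del: times_complex.sel\<close>)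
  qed
qed

text \<open>A sufficiently small rotation of \<open>l\<close> keeps the sign of every nonzero
  determinant, by continuity, and makes the vanishing ones nonzero; finitely many vectors can be
  treated at once.\<close>

lemma generic_direction:
  assumes "finite A" "0 \<notin> A" "l \<noteq> 0"
  obtains l' where "l' \<noteq> 0" "\<And>a. a \<in> A \<Longrightarrow> orient a l' \<noteq> 0"
    "\<And>a. a \<in> A \<Longrightarrow> orient a l \<noteq> 0 \<Longrightarrow> orient a l' = orient a l"
proof -
  have "\<forall>\<^sub>F \<epsilon> in at_right (0::real). \<forall>a\<in>A. Im ((cnj a * l) * Complex 1 (- \<epsilon>)) \<noteq> 0 \<and>
     (Im (cnj a * l) \<noteq> 0 \<longrightarrow> sgn (Im ((cnj a * l) * Complex 1 (- \<epsilon>))) = sgn (Im (cnj a * l)))"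
    using assms by (intro eventually_ball_finite ballI eventually_rotate_nonreal) auto
  then obtain \<epsilon> where \<epsilon>: "\<forall>a\<in>A. Im ((cnj a * l) * Complex 1 (- \<epsilon>)) \<noteq> 0 \<and>
     (Im (cnj a * l) \<noteq> 0 \<longrightarrow> sgn (Im ((cnj a * l) * Complex 1 (- \<epsilon>))) = sgn (Im (cnj a * l)))"
    using eventually_happens'[of "at_right (0::real)"] by auto
  show ?thesis
  proof (rule that[of "l * Complex 1 (- \<epsilon>)"])
    have "Complex 1 (- \<epsilon>) \<noteq> 0" by (simp add: complex_eq_iff)
    with assms show "l * Complex 1 (- \<epsilon>) \<noteq> 0" by simp
  qed (use \<epsilon> in \<open>simp_all only: orient_def mult.assoc sgn_0_0 not_False_eq_True\<close>)
qed

lemma orient_swap: "orient b a = - orient a b"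
  unfolding orient_def by (simp add: sgn_minus[symmetric] mult.commute)

text \<open>Multiplication by \<open>c\<close> scales the determinant by the positive factor
  \<open>(cmod c)^2\<close>.\<close>

lemma orient_mult:
  assumes "c \<noteq> 0"
  shows "orient (c * a) (c * b) = orient a b"
proof -
  have "cnj (c * a) * (c * b) = (cmod c)\<^sup>2 *\<^sub>R (cnj a * b)"
    using complex_norm_square[of c] by (simp add: scaleR_conv_of_real ac_simps)
  then have "Im (cnj (c * a) * (c * b)) = (cmod c)\<^sup>2 * Im (cnj a * b)" by simp
  then show ?thesis unfolding orient_def using assms by (simp only: sgn_mult) simp
qed

lemma orient_scaleR:
  assumes "r > 0"
  shows "orient a (r *\<^sub>R b) = orient a b" "orient (r *\<^sub>R a) b = orient a b"
proof -
  have "cnj a * (r *\<^sub>R b) = r *\<^sub>R (cnj a * b)" "cnj (r *\<^sub>R a) * b = r *\<^sub>R (cnj a * b)"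
    by simp_all
  then show "orient a (r *\<^sub>R b) = orient a b" "orient (r *\<^sub>R a) b = orient a b"
    unfolding orient_def using assms by (simp_all only: scaleR_complex.sel sgn_mult) simp_all
qed

text \<open>\<open>c * l\<close> is a positive multiple of \<open>\<i>\<close>: the factor
  \<open>c\<close> takes the reference direction to the vertical without affecting
  orientations.\<close>

lemma turns_through_rotate:
  assumes "l \<noteq> 0" "c = \<i> * cnj l"
  shows "turns_through l a b \<longleftrightarrow> turns_through \<i> (c * a) (c * b)"
proof -
  have c: "c \<noteq> 0" using assms by auto
  have "c * l = (cmod l)\<^sup>2 *\<^sub>R \<i>"
    using assms by (simp add: scaleR_conv_of_real)
      (metis complex_norm_square mult.assoc mult.commute of_real_power)
  then have "orient (c * a) \<i> = orient a l" "orient \<i> (c * b) = orient l b"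
    using orient_mult[OF c, of a l] orient_mult[OF c, of l b] assms
    by (simp_all add: orient_scaleR)
  then show ?thesis by (simp add: turns_through_def orient_mult[OF c])
qed

text \<open>The reference direction is perturbed until no two vertices differ by a parallel vector,
  and then rotated to the vertical. No edge is parallel to \<open>l\<close>, so neither change
  affects the turning condition.\<close>

theorem sign_closed_polygons:
  fixes Z :: "'a \<Rightarrow> complex"
  assumes fin: "finite S" and p: "p permutes S" and inj: "inj_on Z S"
    and p_neq: "\<And>u. u \<in> S \<Longrightarrow> p u \<noteq> u" and pp_neq: "\<And>u. u \<in> S \<Longrightarrow> p (p u) \<noteq> u"
    and seg: "\<And>u v. \<lbrakk>u \<in> S; v \<in> S; u \<noteq> v\<rbrakk> \<Longrightarrow>
      closed_segment (Z u) (Z (p u)) \<inter> closed_segment (Z v) (Z (p v)) \<subseteq> {Z u, Z (p u)} \<inter> {Z v, Z (p v)}"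
    and l: "l \<noteq> 0" "\<And>u. u \<in> S \<Longrightarrow> orient (Z (p u) - Z u) l \<noteq> 0"
  shows "sign p = (- 1) ^ card S *
    (\<Prod>u\<in>S. if turns_through l (Z (p u) - Z u) (Z (p (p u)) - Z (p u)) then - 1 else 1)"
proof -
  \<comment> \<open>All differences of vertices, not only those along edges: this makes all
    abscissae distinct after the rotation.\<close>
  define A where "A = (\<lambda>(u, v). Z v - Z u) ` {(u, v). u \<in> S \<and> v \<in> S \<and> u \<noteq> v}"
  have pS: "p x \<in> S \<longleftrightarrow> x \<in> S" for x
    by (rule permutes_in_image[OF p])
  have "finite {(u, v). u \<in> S \<and> v \<in> S \<and> u \<noteq> v}"
    by (rule finite_subset[of _ "S \<times> S"]) (use fin in auto)
  then have "finite A" by (simp add: A_def)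
  moreover have "0 \<notin> A" using inj by (auto simp: A_def dest: inj_onD)
  ultimately obtain l' where l': "l' \<noteq> 0" "\<And>a. a \<in> A \<Longrightarrow> orient a l' \<noteq> 0"
    "\<And>a. a \<in> A \<Longrightarrow> orient a l \<noteq> 0 \<Longrightarrow> orient a l' = orient a l"
    using generic_direction l(1) by metis
  have AI: "Z v - Z u \<in> A" if "u \<in> S" "v \<in> S" "u \<noteq> v" for u v
    using that by (auto simp: A_def)
  define c where "c = \<i> * cnj l'"
  have c: "c \<noteq> 0" using l' by (simp add: c_def)
  have "sign p = (- 1) ^ card S * (\<Prod>u\<in>S. if turns_through \<i> (c * Z (p u) - c * Z u)
      (c * Z (p (p u)) - c * Z (p u)) then - 1 else 1)"
  proof (rule sign_closed_polygons_vertical[OF fin p])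
    show "inj_on (\<lambda>u. Re (c * Z u)) S"
    proof (rule inj_onI)
      fix u v assume uv: "u \<in> S" "v \<in> S" and eq: "Re (c * Z u) = Re (c * Z v)"
      show "u = v"
      proof (rule ccontr)
        assume "u \<noteq> v"
        then have "orient (Z v - Z u) l' \<noteq> 0" using AI[OF uv] l'(2) by blast
        \<comment> \<open>The determinant against \<open>l'\<close> is the difference of the rotated
          abscissae.\<close>
        moreover have "Im (cnj (Z v - Z u) * l') = Re (c * Z v) - Re (c * Z u)"
          by (simp add: c_def algebra_simps)
        ultimately show False using eq by (simp add: orient_def del: times_complex.sel)
      qed
    qed
    show "closed_segment (c * Z u) (c * Z (p u)) \<inter> closed_segment (c * Z v) (c * Z (p v))
        \<subseteq> {c * Z u, c * Z (p u)} \<inter> {c * Z v, c * Z (p v)}" if "u \<in> S" "v \<in> S" "u \<noteq> v" for u v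
    proof -
      have im: "closed_segment (c * a) (c * b) = (*) c ` closed_segment a b" for a b
        by (rule closed_segment_linear_image) (rule linear_times)
      have "inj ((*) c)" using c by (auto intro: injI)
      then have "closed_segment (c * Z u) (c * Z (p u)) \<inter> closed_segment (c * Z v) (c * Z (p v))
        = (*) c ` (closed_segment (Z u) (Z (p u)) \<inter> closed_segment (Z v) (Z (p v)))"
        unfolding im by (simp add: image_Int)
      also have "\<dots> \<subseteq> (*) c ` ({Z u, Z (p u)} \<inter> {Z v, Z (p v)})"
        using seg[OF that] by blast
      finally show ?thesis by auto
    qed
  qed (use p_neq pp_neq in auto)
  moreover have "turns_through \<i> (c * Z (p u) - c * Z u) (c * Z (p (p u)) - c * Z (p u))
    \<longleftrightarrow> turns_through l (Z (p u) - Z u) (Z (p (p u)) - Z (p u))" if u: "u \<in> S" for u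
  proof -
    have o: "orient (Z (p v) - Z v) l' = orient (Z (p v) - Z v) l" if "v \<in> S" for v
      using that l(2)[of v] AI[of v "p v"] p_neq[of v] by (intro l'(3)) (auto simp: pS)
    have "turns_through \<i> (c * Z (p u) - c * Z u) (c * Z (p (p u)) - c * Z (p u))
      \<longleftrightarrow> turns_through l' (Z (p u) - Z u) (Z (p (p u)) - Z (p u))"
      using turns_through_rotate[OF l'(1) c_def] by (simp add: right_diff_distrib)
    also have "\<dots> \<longleftrightarrow> turns_through l (Z (p u) - Z u) (Z (p (p u)) - Z (p u))"
      using o[of u] o[of "p u"] u orient_swap[of "Z (p (p u)) - Z (p u)"]
      unfolding turns_through_def by (simp add: pS)
    finally show ?thesis .
  qed
  ultimately show ?thesis by simp
qed

section \<open>Rays crossing closed polygons\<close>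

text \<open>Inside the disk the ray fills its whole line: if an interior point lay at or behind the
  base point \<open>x\<close>, convexity would put \<open>x\<close> in the interior.\<close>

lemma ray_eq_line_in_interior:
  assumes D: "convex D" and x: "x \<in> frontier D" and l: "l \<noteq> 0"
    and inward: "\<forall>\<^sub>F t in at_right 0. x + t *\<^sub>R l \<in> interior D"
    and z: "z \<in> interior D"
  shows "z \<in> ray x l \<longleftrightarrow> Im (cnj l * (z - x)) = 0"
proof
  assume "z \<in> ray x l"
  then obtain t where "z = x + t *\<^sub>R l" by (auto simp: ray_def)
  then have "cnj l * (z - x) = t *\<^sub>R (cnj l * l)" by simp
  then show "Im (cnj l * (z - x)) = 0" by simp
next
  assume 0: "Im (cnj l * (z - x)) = 0"
  \<comment> \<open>The coordinate of \<open>z\<close> on the line through \<open>x\<close> with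
    direction \<open>l\<close>.\<close>
  define s where "s = Re (cnj l * (z - x)) / (cmod l)\<^sup>2"
  have "cnj l * (z - x) = of_real (Re (cnj l * (z - x)))"
    using 0 by (simp add: complex_eq_iff del: times_complex.sel)
  also have "\<dots> = cnj l * (s *\<^sub>R l)"
    using l complex_norm_square[of l] by (simp add: s_def scaleR_conv_of_real field_simps)
  finally have "z - x = s *\<^sub>R l" using l by (simp del: mult_scaleR_right)
  then have zs: "z = x + s *\<^sub>R l" by (simp add: algebra_simps)
  have "s > 0"
  proof (rule ccontr)
    assume "\<not> s > 0"
    have "\<forall>\<^sub>F t in at_right (0::real). t > 0 \<and> x + t *\<^sub>R l \<in> interior D"
      using inward eventually_at_right_less by (intro eventually_conj) auto
    then obtain t :: real where t: "t > 0" "x + t *\<^sub>R l \<in> interior D"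
      using eventually_happens'[of "at_right (0::real)"] by auto
    \<comment> \<open>With this weight the combination of \<open>z\<close> and the point at
      parameter \<open>t\<close> is \<open>x\<close>, as
      \<open>a * s + (1 - a) * t = 0\<close>.\<close>
    define a where "a = t / (t - s)"
    have ts: "t - s > 0" using t \<open>\<not> s > 0\<close> by simp
    then have "0 \<le> a" "a \<le> 1" using t \<open>\<not> s > 0\<close> by (auto simp: a_def divide_simps)
    have "a * s + (1 - a) * t = 0" using ts by (simp add: a_def field_simps)
    then have "a *\<^sub>R z + (1 - a) *\<^sub>R (x + t *\<^sub>R l) = x"
      unfolding zs by (simp add: algebra_simps flip: scaleR_add_left)
    moreover have "a *\<^sub>R z + (1 - a) *\<^sub>R (x + t *\<^sub>R l) \<in> interior D"
      using convexD[OF convex_interior[OF D] z t(2)] \<open>0 \<le> a\<close> \<open>a \<le> 1\<close> by auto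
    ultimately show False using x by (simp add: frontier_def)
  qed
  with zs show "z \<in> ray x l" by (auto simp: ray_def)
qed

text \<open>\<open>Im (cnj l * (z - x))\<close> is affine along the segment and nonzero at both
  ends, so it has one zero if its signs there differ and none otherwise. Inside the disk its zeros
  are the points of the ray.\<close>

lemma ray_inter_segment:
  assumes D: "convex D" and x: "x \<in> frontier D" and l: "l \<noteq> 0"
    and inward: "\<forall>\<^sub>F t in at_right 0. x + t *\<^sub>R l \<in> interior D"
    and a: "a \<in> interior D" "a \<notin> ray x l" and b: "b \<in> interior D" "b \<notin> ray x l"
  shows "finite (ray x l \<inter> closed_segment a b)"
    and "of_nat (card (ray x l \<inter> closed_segment a b)) =
      of_bool (Im (cnj l * (a - x)) < 0) + (of_bool (Im (cnj l * (b - x)) < 0) :: bit)"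
proof -
  define g where "g z = Im (cnj l * (z - x))" for z
  have on_ray: "z \<in> ray x l \<longleftrightarrow> g z = 0" if "z \<in> interior D" for z
    unfolding g_def by (rule ray_eq_line_in_interior[OF D x l inward that])
  have nz: "g a \<noteq> 0" "g b \<noteq> 0" using on_ray a b by auto
  have g: "g ((1 - t) *\<^sub>R a + t *\<^sub>R b) = (1 - t) * g a + t * g b" for t
    unfolding g_def by (simp add: algebra_simps)
  have sub: "closed_segment a b \<subseteq> interior D"
    using a b convex_interior[OF D] by (intro closed_segment_subset) auto
  have eq: "ray x l \<inter> closed_segment a b =
     (\<lambda>t. (1 - t) *\<^sub>R a + t *\<^sub>R b) ` {t. 0 \<le> t \<and> t \<le> 1 \<and> (1 - t) * g a + t * g b = 0}"
    using on_ray sub unfolding closed_segment_def by (auto simp: g)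
  have "finite (ray x l \<inter> closed_segment a b) \<and> of_nat (card (ray x l \<inter> closed_segment a b)) =
      of_bool (g a < 0) + (of_bool (g b < 0) :: bit)"
  proof (cases "g a < 0 \<longleftrightarrow> g b < 0")
    case True
    have "(1 - t) * g a + t * g b \<noteq> 0" if "0 \<le> t" "t \<le> 1" for t
    proof (cases "g a < 0")
      case neg: True
      then have "(1 - t) * g a + t * g b < 0"
        using True that nz by (cases "t = 0") (auto intro: add_nonpos_neg simp: mult_nonneg_nonpos mult_pos_neg)
      then show ?thesis by simp
    next
      case pos: False
      then have "g a > 0" "g b > 0" using True nz by auto
      then have "(1 - t) * g a + t * g b > 0"
        using that by (cases "t = 0") (auto intro: add_nonneg_pos)
      then show ?thesis by simp
    qed
    then have "ray x l \<inter> closed_segment a b = {}" unfolding eq by auto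
    with True show ?thesis by simp
  next
    case False
    then have ne: "g a \<noteq> g b" by auto
    define t where "t = g a / (g a - g b)"
    have "0 \<le> t" "t \<le> 1" using False nz ne by (auto simp: t_def divide_simps)
    moreover have "(1 - s) * g a + s * g b = 0 \<longleftrightarrow> s = t" for s
      using ne by (auto simp: t_def field_simps)
    ultimately have "{t. 0 \<le> t \<and> t \<le> 1 \<and> (1 - t) * g a + t * g b = 0} = {t}" by auto
    then have "ray x l \<inter> closed_segment a b = {(1 - t) *\<^sub>R a + t *\<^sub>R b}" unfolding eq by simp
    with False show ?thesis by auto
  qed
  then show "finite (ray x l \<inter> closed_segment a b)"
    and "of_nat (card (ray x l \<inter> closed_segment a b)) =
      of_bool (Im (cnj l * (a - x)) < 0) + (of_bool (Im (cnj l * (b - x)) < 0) :: bit)"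
    unfolding g_def by auto
qed

lemma of_nat_bit_eq_0: "of_nat n = (0 :: bit) \<longleftrightarrow> even n"
  by (induction n) auto

text \<open>Each vertex is the tail of one edge and the head of another, so its side of the ray is
  counted twice.\<close>

lemma even_ray_crossings:
  assumes D: "convex D" and x: "x \<in> frontier D" and l: "l \<noteq> 0"
    and inward: "\<forall>\<^sub>F t in at_right 0. x + t *\<^sub>R l \<in> interior D"
    and p: "p permutes S"
    and Z: "\<And>u. u \<in> S \<Longrightarrow> Z u \<in> interior D" "\<And>u. u \<in> S \<Longrightarrow> Z u \<notin> ray x l"
  shows "even (\<Sum>u\<in>S. card (ray x l \<inter> closed_segment (Z u) (Z (p u))))"
proof -
  define h where "h u = (of_bool (Im (cnj l * (Z u - x)) < 0) :: bit)" for u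
  have pS: "p u \<in> S \<longleftrightarrow> u \<in> S" for u
    by (rule permutes_in_image[OF p])
  have "of_nat (\<Sum>u\<in>S. card (ray x l \<inter> closed_segment (Z u) (Z (p u)))) = (\<Sum>u\<in>S. h u + h (p u))"
    unfolding of_nat_sum h_def
    using Z pS by (intro sum.cong refl ray_inter_segment(2)[OF D x l inward]) auto
  also have "\<dots> = (\<Sum>u\<in>S. h u) + (\<Sum>u\<in>S. h u)"
    using sum.permute[OF p, of h] by (simp add: sum.distrib o_def)
  finally show ?thesis unfolding bit_add_self of_nat_bit_eq_0 .
qed

section \<open>Determinants of transition matrices\<close>

lemma matrix_inverse_if_det_nonzero:
  fixes A :: "'a :: field mat"
  assumes A: "A \<in> carrier_mat n n" and d: "Determinant.det A \<noteq> 0"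
  obtains B where "B \<in> carrier_mat n n" "A * B = 1\<^sub>m n" "B * A = 1\<^sub>m n"
  using det_non_zero_imp_unit[OF A d, of "()"] that
  by (auto simp: Units_def ring_mat_simps)

lemma mat_mult_index_sum:
  assumes "A \<in> carrier_mat n n" "B \<in> carrier_mat n n" "i < n" "j < n"
  shows "(A * B) $$ (i, j) = (\<Sum>k<n. A $$ (i, k) * B $$ (k, j))"
  using assms by (auto simp: scalar_prod_def atLeast0LessThan intro!: sum.cong)

text \<open>The unknowns lie in an arbitrary real vector space, so the inverse matrix is applied to
  families of vectors; its products with \<open>A\<close> on the two sides give existence and
  uniqueness.\<close>

lemma linear_system_in_vector_space:
  fixes A :: "real mat" and b :: "nat \<Rightarrow> 'v::real_vector"
  assumes A: "A \<in> carrier_mat n n" and d: "Determinant.det A \<noteq> 0"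
  shows "\<exists>x. \<forall>r<n. (\<Sum>c<n. A $$ (r, c) *\<^sub>R x c) = b r"
    and "\<lbrakk>\<forall>r<n. (\<Sum>c<n. A $$ (r, c) *\<^sub>R x c) = b r;
          \<forall>r<n. (\<Sum>c<n. A $$ (r, c) *\<^sub>R y c) = b r; i < n\<rbrakk> \<Longrightarrow> x i = y i"
proof -
  obtain M where M: "M \<in> carrier_mat n n" "A * M = 1\<^sub>m n" "M * A = 1\<^sub>m n"
    using matrix_inverse_if_det_nonzero[OF A d] by metis
  have comp: "(\<Sum>k<n. P $$ (i, k) *\<^sub>R (\<Sum>j<n. R $$ (k, j) *\<^sub>R z j)) = z i"
    if "P * R = 1\<^sub>m n" "P \<in> carrier_mat n n" "R \<in> carrier_mat n n" "i < n"
    for P R :: "real mat" and z :: "nat \<Rightarrow> 'v" and i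
  proof -
    have "(\<Sum>k<n. P $$ (i, k) *\<^sub>R (\<Sum>j<n. R $$ (k, j) *\<^sub>R z j))
        = (\<Sum>j<n. (\<Sum>k<n. P $$ (i, k) * R $$ (k, j)) *\<^sub>R z j)"
      unfolding scaleR_sum_right scaleR_sum_left scaleR_scaleR by (rule sum.swap)
    also have "\<dots> = (\<Sum>j<n. (if i = j then z j else 0))"
    proof (intro sum.cong refl)
      fix j assume "j \<in> {..<n}"
      then have "(\<Sum>k<n. P $$ (i, k) * R $$ (k, j)) = 1\<^sub>m n $$ (i, j)"
        using mat_mult_index_sum[OF that(2,3,4), of j] unfolding that(1) by simp
      then show "(\<Sum>k<n. P $$ (i, k) * R $$ (k, j)) *\<^sub>R z j = (if i = j then z j else 0)"
        using that(4) \<open>j \<in> {..<n}\<close> by simp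
    qed
    finally show ?thesis using that by simp
  qed
  show "\<exists>x. \<forall>r<n. (\<Sum>c<n. A $$ (r, c) *\<^sub>R x c) = b r"
    by (rule exI[of _ "\<lambda>c. \<Sum>j<n. M $$ (c, j) *\<^sub>R b j"]) (auto intro: comp M A)
  assume x: "\<forall>r<n. (\<Sum>c<n. A $$ (r, c) *\<^sub>R x c) = b r"
    and y: "\<forall>r<n. (\<Sum>c<n. A $$ (r, c) *\<^sub>R y c) = b r" and i: "i < n"
  have "x i = (\<Sum>k<n. M $$ (i, k) *\<^sub>R b k)" "y i = (\<Sum>k<n. M $$ (i, k) *\<^sub>R b k)"
    using comp[OF M(3,1) A i, of x] comp[OF M(3,1) A i, of y] x y by simp_all
  then show "x i = y i" by simp
qed

section \<open>Permutations that follow arcs\<close>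

definition transition_perms :: "nat \<Rightarrow> (nat \<Rightarrow> 'v) \<Rightarrow> (nat \<Rightarrow> 'v) \<Rightarrow> (nat \<Rightarrow> nat) set" where
  "transition_perms n t h =
     {p. p permutes {0..<n} \<and> (\<forall>i<n. p i \<noteq> i \<longrightarrow> t (p i) = h i)}"

text \<open>\<open>t\<close> and \<open>h\<close> stand for the tail and head of the arc with a
  given index. Without loops the diagonal entries are 1, so fixed points contribute the factor 1,
  and a moved index makes the term vanish unless it is sent to an arc starting at its head.\<close>

lemma det_transition_matrix:
  fixes c :: "nat \<Rightarrow> nat \<Rightarrow> 'a :: comm_ring_1"
  assumes "\<And>i. i < n \<Longrightarrow> t i \<noteq> h i"
  shows "Determinant.det (mat n n (\<lambda>(i, j). of_bool (j = i) - (if t j = h i then c i j else 0))) =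
    (\<Sum>p\<in>transition_perms n t h. signof p * (\<Prod>i | p i \<noteq> i. - c i (p i)))"
proof -
  let ?m = "\<lambda>i j. of_bool (j = i) - (if t j = h i then c i j else 0)"
  have "Determinant.det (mat n n (\<lambda>(i, j). ?m i j)) =
     (\<Sum>p | p permutes {0..<n}. signof p * (\<Prod>i = 0..<n. ?m i (p i)))"
    unfolding Determinant.det_def
    by (auto intro!: sum.cong arg_cong2[of _ _ _ _ "(*)"] prod.cong dest: permutes_in_image)
  also have "\<dots> = (\<Sum>p\<in>transition_perms n t h. signof p * (\<Prod>i = 0..<n. ?m i (p i)))"
  proof (rule sum.mono_neutral_right)
    show "\<forall>p\<in>{p. p permutes {0..<n}} - transition_perms n t h.
       signof p * (\<Prod>i = 0..<n. ?m i (p i)) = 0"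
    proof
      fix p assume "p \<in> {p. p permutes {0..<n}} - transition_perms n t h"
      then obtain i where "i < n" "p i \<noteq> i" "t (p i) \<noteq> h i" by (auto simp: transition_perms_def)
      then have "\<exists>i\<in>{0..<n}. ?m i (p i) = 0" by (intro bexI[of _ i]) auto
      then have "(\<Prod>i = 0..<n. ?m i (p i)) = 0" by (intro prod_zero) auto
      then show "signof p * (\<Prod>i = 0..<n. ?m i (p i)) = 0" by simp
    qed
  qed (auto simp: transition_perms_def finite_permutations)
  also have "\<dots> = (\<Sum>p\<in>transition_perms n t h. signof p * (\<Prod>i | p i \<noteq> i. - c i (p i)))"
  proof (intro sum.cong refl arg_cong2[of _ _ _ _ "(*)"])
    fix p assume p: "p \<in> transition_perms n t h"
    then have sub: "{i. p i \<noteq> i} \<subseteq> {0..<n}"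
      by (auto simp: transition_perms_def dest: permutes_not_in)
    have "(\<Prod>i = 0..<n. ?m i (p i)) = (\<Prod>i | p i \<noteq> i. ?m i (p i))"
      using assms sub by (intro prod.mono_neutral_right) (auto simp: not_less)
    also have "\<dots> = (\<Prod>i | p i \<noteq> i. - c i (p i))"
      using p sub by (intro prod.cong refl) (auto simp: transition_perms_def)
    finally show "(\<Prod>i = 0..<n. ?m i (p i)) = (\<Prod>i | p i \<noteq> i. - c i (p i))" .
  qed
  finally show ?thesis .
qed

lemma moved_permutes:
  assumes "p permutes A"
  shows "p permutes {i. p i \<noteq> i}"
  by (rule permutes_superset[OF assms]) auto

text \<open>For finite \<open>C\<close> this describes a union of directed cycles without common
  vertices.\<close>

definition successor_closed :: "('a \<Rightarrow> 'v) \<Rightarrow> ('a \<Rightarrow> 'v) \<Rightarrow> 'a set \<Rightarrow> bool" where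
  "successor_closed t h C \<longleftrightarrow>
     (\<forall>i\<in>C. \<exists>!j. j \<in> C \<and> t j = h i) \<and> (\<forall>j\<in>C. \<exists>!i. i \<in> C \<and> h i = t j)"

text \<open>The set of moved indices determines \<open>p\<close>, because successors in that set are
  unique. The hypothesis \<open>branch\<close> rules out vertices with two arcs in and two arcs out,
  at which cycles could meet and exchange successors.\<close>

lemma bij_betw_transition_perms:
  assumes loopfree: "\<And>i. i < n \<Longrightarrow> t i \<noteq> h i"
    and branch: "\<And>i j i' j'. \<lbrakk>i < n; j < n; i' < n; j' < n; h i = h j; t i' = h i; t j' = h i\<rbrakk>
      \<Longrightarrow> i = j \<or> i' = j'"
  shows "bij_betw (\<lambda>p. {i. p i \<noteq> i}) (transition_perms n t h)
    {C. C \<subseteq> {..<n} \<and> successor_closed t h C}"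
proof -
  have moved: "{i. p i \<noteq> i} \<subseteq> {..<n}" "successor_closed t h {i. p i \<noteq> i}"
    if "p \<in> transition_perms n t h" for p
  proof -
    define C where "C = {i. p i \<noteq> i}"
    have p: "p permutes {0..<n}" and th: "\<And>i. i \<in> C \<Longrightarrow> t (p i) = h i"
      using that by (auto simp: transition_perms_def C_def) (metis atLeastLessThan_iff permutes_not_in zero_le)
    show sub: "{i. p i \<noteq> i} \<subseteq> {..<n}" using p by (auto dest: permutes_not_in)
    have pC: "p i \<in> C \<longleftrightarrow> i \<in> C" for i
      using permutes_in_image[OF moved_permutes[OF p]] by (simp add: C_def)
    have Cn: "i \<in> C \<Longrightarrow> i < n" for i using sub by (auto simp: C_def)
    have surj: "\<exists>i\<in>C. j = p i" if "j \<in> C" for j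
      using permutes_image[OF moved_permutes[OF p]] that unfolding C_def by blast
    show "successor_closed t h {i. p i \<noteq> i}"
      unfolding successor_closed_def C_def[symmetric]
    proof (intro conjI ballI)
      fix i assume i: "i \<in> C"
      show "\<exists>!j. j \<in> C \<and> t j = h i"
      proof (rule ex1I[of _ "p i"])
        fix j assume j: "j \<in> C \<and> t j = h i"
        obtain k where k: "k \<in> C" "j = p k" using surj j by blast
        then have "h i = h k" using th[OF k(1)] j by simp
        \<comment> \<open>Moved arcs ending at the same vertex coincide or have the same successor;
          either gives \<open>j = p i\<close>.\<close>
        from branch[OF Cn[OF i] Cn[OF k(1)] Cn[OF pC[THEN iffD2, OF i]] Cn[OF conjunct1[OF j]]
            this th[OF i] conjunct2[OF j]]
        show "j = p i" using k(2) by metis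
      qed (simp add: i th pC)
    next
      fix j assume j: "j \<in> C"
      obtain i where i: "i \<in> C" "j = p i" using surj j by blast
      show "\<exists>!i. i \<in> C \<and> h i = t j"
      proof (rule ex1I[of _ i])
        fix k assume k: "k \<in> C \<and> h k = t j"
        have hk: "h k = h i" using th[OF i(1)] i(2) k by simp
        from branch[OF Cn[OF conjunct1[OF k]] Cn[OF i(1)] Cn[OF pC[THEN iffD2, OF conjunct1[OF k]]]
            Cn[OF pC[THEN iffD2, OF i(1)]] hk th[OF conjunct1[OF k]] trans[OF th[OF i(1)] hk[symmetric]]]
        show "k = i" using permutes_inj[OF p] by (metis injD)
      qed (simp add: i th)
    qed
  qed
  show ?thesis
  proof (rule bij_betw_imageI)
    show "inj_on (\<lambda>p. {i. p i \<noteq> i}) (transition_perms n t h)"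
    proof (rule inj_onI)
      fix p q assume pq: "p \<in> transition_perms n t h" "q \<in> transition_perms n t h"
        "{i. p i \<noteq> i} = {i. q i \<noteq> i}"
      have eqv: "p i \<noteq> i \<longleftrightarrow> q i \<noteq> i" for i using pq(3) by blast
      show "p = q"
      proof
        fix i
        show "p i = q i"
        proof (cases "p i = i")
          case True
          then show ?thesis using eqv[of i] by simp
        next
          case False
          then have F: "q i \<noteq> i" using eqv by blast
          have i: "i < n" using moved(1)[OF pq(1)] False by auto
          have "p permutes {0..<n}" "q permutes {0..<n}"
            using pq(1,2) by (simp_all add: transition_perms_def)
          then have "p (p i) \<noteq> p i" "q (q i) \<noteq> q i"
            using False F by (metis injD permutes_inj)+
          then have "p i \<in> {i. p i \<noteq> i}" "q i \<in> {i. p i \<noteq> i}" using eqv[of "q i"] by simp_all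
          moreover have "t (p i) = h i" "t (q i) = h i" using pq(1,2) i False F by (simp_all add: transition_perms_def)
          ultimately show ?thesis
            using moved(2)[OF pq(1)] False unfolding successor_closed_def by blast
        qed
      qed
    qed
  next
    show "(\<lambda>p. {i. p i \<noteq> i}) ` transition_perms n t h = {C. C \<subseteq> {..<n} \<and> successor_closed t h C}"
    proof (rule equalityI; rule subsetI)
      fix C assume "C \<in> (\<lambda>p. {i. p i \<noteq> i}) ` transition_perms n t h"
      then show "C \<in> {C. C \<subseteq> {..<n} \<and> successor_closed t h C}" using moved by blast
    next
      fix C assume "C \<in> {C. C \<subseteq> {..<n} \<and> successor_closed t h C}"
      then have Cn: "C \<subseteq> {..<n}" and sc: "successor_closed t h C" by auto
      \<comment> \<open>\<open>p\<close> follows \<open>C\<close> and fixes all other indices.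
        Unique predecessors make it injective on \<open>C\<close>, hence bijective by
        finiteness.\<close>
      define p where "p i = (if i \<in> C then THE j. j \<in> C \<and> t j = h i else i)" for i
      have p: "p i \<in> C \<and> t (p i) = h i" if "i \<in> C" for i
        using sc theI'[of "\<lambda>j. j \<in> C \<and> t j = h i"] that by (simp add: successor_closed_def p_def)
      have p_id: "p i = i" if "i \<notin> C" for i using that by (simp add: p_def)
      have "inj_on p C"
      proof (rule inj_onI)
        fix i k assume "i \<in> C" "k \<in> C" "p i = p k"
        with p[of i] p[of k] sc show "i = k" unfolding successor_closed_def by metis
      qed
      moreover have "finite C" using Cn finite_subset by blast
      moreover have "p ` C \<subseteq> C" using p by auto
      ultimately have "bij_betw p C C" by (simp add: bij_betw_def endo_inj_surj)
      then have "p permutes C" by (rule bij_imp_permutes) (rule p_id)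
      then have "p permutes {0..<n}" by (rule permutes_subset) (use Cn in auto)
      then have "p \<in> transition_perms n t h" using p p_id by (auto simp: transition_perms_def)
      moreover have "{i. p i \<noteq> i} = C"
      proof (rule equalityI; rule subsetI)
        fix i assume "i \<in> {i. p i \<noteq> i}"
        then show "i \<in> C" using p_id by auto
      next
        fix i assume "i \<in> C"
        then have "t (p i) = h i" "t i \<noteq> h i" using p loopfree Cn by auto
        then show "i \<in> {i. p i \<noteq> i}" by auto
      qed
      ultimately show "C \<in> (\<lambda>p. {i. p i \<noteq> i}) ` transition_perms n t h" by blast
    qed
  qed
qed

text \<open>The vectors outside \<open>set es\<close> are prescribed by \<open>G\<close>; collecting
  them in the right-hand side \<open>b\<close> leaves a square system. Extensionality fixes the
  values outside \<open>A\<close>, so that the solution is unique as a function.\<close>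

lemma ex1_vector_solution:
  fixes a :: "'e \<Rightarrow> 'e \<Rightarrow> real" and G :: "'e \<Rightarrow> 'v::real_vector"
  assumes A: "finite A" "set es \<subseteq> A" "distinct es"
    and d: "Determinant.det (mat (length es) (length es)
      (\<lambda>(r, c). of_bool (es ! c = es ! r) - a (es ! r) (es ! c))) \<noteq> 0"
  shows "\<exists>!E. E \<in> extensional A \<and> (\<forall>e\<in>A - set es. E e = G e) \<and>
    (\<forall>e\<in>set es. E e = (\<Sum>f\<in>A. a e f *\<^sub>R E f))"
proof -
  let ?n = "length es"
  define M where "M = mat ?n ?n (\<lambda>(r, c). of_bool (es ! c = es ! r) - a (es ! r) (es ! c))"
  define b where "b r = (\<Sum>f\<in>A - set es. a (es ! r) f *\<^sub>R G f)" for r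
  have M: "M \<in> carrier_mat ?n ?n" "Determinant.det M \<noteq> 0"
    using d by (auto simp: M_def)
  have bij: "bij_betw ((!) es) {..<?n} (set es)"
    using A(3) by (intro bij_betw_nth) auto
  have row: "(\<Sum>c<?n. M $$ (r, c) *\<^sub>R E (es ! c)) = E (es ! r) - (\<Sum>f\<in>set es. a (es ! r) f *\<^sub>R E f)"
    if "r < ?n" for E :: "'e \<Rightarrow> 'v" and r
  proof -
    have "(\<Sum>c<?n. M $$ (r, c) *\<^sub>R E (es ! c))
        = (\<Sum>c<?n. (of_bool (es ! c = es ! r) - a (es ! r) (es ! c)) *\<^sub>R E (es ! c))"
      using that by (intro sum.cong) (auto simp: M_def)
    also have "\<dots> = (\<Sum>f\<in>set es. (of_bool (f = es ! r) - a (es ! r) f) *\<^sub>R E f)"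
      by (rule sum.reindex_bij_betw[OF bij, of "\<lambda>f. (of_bool (f = es ! r) - a (es ! r) f) *\<^sub>R E f"])
    also have "\<dots> = (\<Sum>f\<in>set es. (if f = es ! r then E f else 0)) - (\<Sum>f\<in>set es. a (es ! r) f *\<^sub>R E f)"
      unfolding sum_subtractf[symmetric] by (intro sum.cong) (auto simp: scaleR_left_diff_distrib)
    finally show ?thesis using that by (simp add: sum.delta)
  qed
  have iff: "(\<forall>e\<in>set es. E e = (\<Sum>f\<in>A. a e f *\<^sub>R E f)) \<longleftrightarrow>
      (\<forall>r<?n. (\<Sum>c<?n. M $$ (r, c) *\<^sub>R E (es ! c)) = b r)"
    if K: "\<forall>e\<in>A - set es. E e = G e" for E
  proof -
    have split: "(\<Sum>f\<in>A. a e f *\<^sub>R E f) = (\<Sum>f\<in>set es. a e f *\<^sub>R E f) + (\<Sum>f\<in>A - set es. a e f *\<^sub>R G f)" for e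
    proof -
      have "(\<Sum>f\<in>A. a e f *\<^sub>R E f) = (\<Sum>f\<in>A - set es. a e f *\<^sub>R E f) + (\<Sum>f\<in>set es. a e f *\<^sub>R E f)"
        using A by (intro sum.subset_diff) auto
      also have "(\<Sum>f\<in>A - set es. a e f *\<^sub>R E f) = (\<Sum>f\<in>A - set es. a e f *\<^sub>R G f)"
        using K by (intro sum.cong) auto
      finally show ?thesis by (simp add: add.commute)
    qed
    have "(\<forall>e\<in>set es. E e = (\<Sum>f\<in>A. a e f *\<^sub>R E f)) \<longleftrightarrow>
      (\<forall>r<?n. E (es ! r) = (\<Sum>f\<in>A. a (es ! r) f *\<^sub>R E f))"
      by (simp add: all_set_conv_all_nth)
    also have "\<dots> \<longleftrightarrow> (\<forall>r<?n. (\<Sum>c<?n. M $$ (r, c) *\<^sub>R E (es ! c)) = b r)"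
      by (simp add: row b_def split diff_eq_eq add.commute)
    finally show ?thesis .
  qed
  obtain x where x: "\<forall>r<?n. (\<Sum>c<?n. M $$ (r, c) *\<^sub>R x c) = b r"
    using linear_system_in_vector_space(1)[OF M] by blast
  define idx where "idx = the_inv_into {..<?n} ((!) es)"
  have idx: "idx (es ! c) = c" if "c < ?n" for c
    unfolding idx_def using bij that by (intro the_inv_into_f_f) (auto simp: bij_betw_def)
  define E where "E = restrict (\<lambda>e. if e \<in> set es then x (idx e) else G e) A"
  have E: "E \<in> extensional A" "\<forall>e\<in>A - set es. E e = G e" "\<And>c. c < ?n \<Longrightarrow> E (es ! c) = x c"
    using A nth_mem by (auto simp: E_def idx subset_iff)
  show ?thesis
  proof (rule ex1I[of _ E])
    have "\<forall>r<?n. (\<Sum>c<?n. M $$ (r, c) *\<^sub>R E (es ! c)) = b r" using x E(3) by simp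
    then show "E \<in> extensional A \<and> (\<forall>e\<in>A - set es. E e = G e) \<and>
      (\<forall>e\<in>set es. E e = (\<Sum>f\<in>A. a e f *\<^sub>R E f))"
      using E iff[OF E(2)] by blast
  next
    fix F assume F: "F \<in> extensional A \<and> (\<forall>e\<in>A - set es. F e = G e) \<and>
      (\<forall>e\<in>set es. F e = (\<Sum>f\<in>A. a e f *\<^sub>R F f))"
    then have "\<forall>r<?n. (\<Sum>c<?n. M $$ (r, c) *\<^sub>R F (es ! c)) = b r" using iff[of F] by blast
    from linear_system_in_vector_space(2)[OF M this x]
    have Fx: "F (es ! c) = x c" if "c < ?n" for c using that by simp
    show "F = E"
    proof (rule extensionalityI[of _ A])
      fix e assume "e \<in> A"
      show "F e = E e"
      proof (cases "e \<in> set es")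
        case True
        then obtain c where "c < ?n" "e = es ! c" by (auto simp: in_set_conv_nth)
        then show ?thesis using Fx E(3) by simp
      qed (use F E \<open>e \<in> A\<close> in auto)
    qed (use F E in auto)
  qed
qed

section \<open>Plabic networks and their linear systems\<close>

context plabic
begin

sublocale G: fin_digraph "dig N"
  by (rule finite_graph)

section \<open>Boundary and degrees of a plabic network\<close>

lemma disk_facts:
  shows convex_disk: "convex (disk N)"
    and bd_frontier: "i \<in> {1..bd_num N} \<Longrightarrow> bd N i \<in> frontier (disk N)"
    and inj_bd: "inj_on (bd N) {1..bd_num N}"
proof -
  from disk obtain p q t where
    conv: "convex (disk N)" and pq: "p \<noteq> q" "closed_segment p q \<subseteq> frontier (disk N)"
    and t: "strict_mono_on {1..bd_num N} t"
      "\<forall>i\<in>{1..bd_num N}. t i \<in> {0..1} \<and> bd N i = p + (t i :: real) *\<^sub>R (q - p)"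
    unfolding disk_with_boundary_points_def by blast
  show "convex (disk N)" by (rule conv)
  show "bd N i \<in> frontier (disk N)" if "i \<in> {1..bd_num N}"
  proof -
    have "bd N i = (1 - t i) *\<^sub>R p + t i *\<^sub>R q" "0 \<le> t i" "t i \<le> 1"
      using t(2) that by (auto simp: algebra_simps)
    then have "bd N i \<in> closed_segment p q" by (auto simp: closed_segment_def)
    then show ?thesis using pq by blast
  qed
  show "inj_on (bd N) {1..bd_num N}"
  proof (rule inj_onI)
    fix i j assume ij: "i \<in> {1..bd_num N}" "j \<in> {1..bd_num N}" "bd N i = bd N j"
    then have "t i *\<^sub>R (q - p) = t j *\<^sub>R (q - p)" using t(2) by (metis add_left_cancel)
    then have "t i = t j" using pq by simp
    then show "i = j" using strict_mono_on_imp_inj_on[OF t(1)] ij by (auto dest: inj_onD)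
  qed
qed

lemma finite_unknown_edges: "finite (unknown_edges N)"
  unfolding unknown_edges_def by simp

text \<open>A boundary source has degree 1, used up by its outgoing arc, so an arc that ends on the
  boundary ends at a sink.\<close>

lemma unknown_edges_iff:
  assumes "e \<in> arcs (dig N)"
  shows "e \<in> unknown_edges N \<longleftrightarrow> head (dig N) e \<in> internal_verts N"
proof
  assume "e \<in> unknown_edges N"
  then have no: "head (dig N) e \<notin> bd N ` sink_idx N" by (simp add: unknown_edges_def)
  show "head (dig N) e \<in> internal_verts N"
  proof (rule ccontr)
    assume "head (dig N) e \<notin> internal_verts N"
    then have b: "head (dig N) e \<in> bd_verts N"
      using assms by (auto simp: internal_verts_def)
    then obtain i where i: "i \<in> {1..bd_num N}" "head (dig N) e = bd N i" by (auto simp: bd_verts_def)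
    with no have "i \<in> source_idx N" by (auto simp: sink_idx_def)
    then have "in_degree (dig N) (bd N i) = 0"
      using bd_degree[OF b] i by (auto simp: source_idx_def)
    moreover have "e \<in> in_arcs (dig N) (bd N i)" using assms i by (simp add: in_arcs_def)
    moreover have "finite (in_arcs (dig N) (bd N i))" by (rule G.finite_in_arcs)
    ultimately show False by (auto simp: in_degree_def)
  qed
next
  assume "head (dig N) e \<in> internal_verts N"
  then show "e \<in> unknown_edges N"
    using assms by (auto simp: unknown_edges_def internal_verts_def bd_verts_def sink_idx_def)
qed

lemma tail_neq_head: "e \<in> arcs (dig N) \<Longrightarrow> tail (dig N) e \<noteq> head (dig N) e"
  using embedding by (auto simp: straight_embedding_def)

text \<open>Perfection in the form that excludes two arcs in and two arcs out at the same
  vertex.\<close>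

lemma unique_in_or_out:
  assumes "v \<in> internal_verts N"
  shows "card (in_arcs (dig N) v) = 1 \<or> card (out_arcs (dig N) v) = 1"
  using perfect[OF assms] by (auto simp: in_degree_def out_degree_def split: colour.splits)

section \<open>One equation for each unknown edge\<close>

definition canonical_equation :: "complex \<Rightarrow> 'e \<Rightarrow> 'e \<times> ('e \<Rightarrow> real)" where
  "canonical_equation l e =
     (e, \<lambda>f. if f \<in> out_arcs (dig N) (head (dig N) e) then edge_coeff N l e f else 0)"

text \<open>Colours and degrees leave one arc in and one out, two in and one out at a black vertex,
  or one in and two out at a white one. In each case an incoming arc has one equation, whose
  right-hand side runs over the arcs leaving the vertex.\<close>

lemma vertex_equations_eq: "vertex_equations N l = canonical_equation l ` unknown_edges N"
proof (rule equalityI; rule subsetI)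
  fix x assume "x \<in> vertex_equations N l"
  moreover obtain e0 a0 where x: "x = (e0, a0)" by (cases x)
  ultimately have "(e0, a0) \<in> vertex_equations N l" by simp
  then have "(e0, a0) \<in> canonical_equation l ` unknown_edges N"
  proof cases
    case (bivalent v f)
    then have "e0 \<in> arcs (dig N)" "head (dig N) e0 = v" by (auto simp: in_arcs_def)
    with bivalent show ?thesis
      by (intro image_eqI[of _ _ e0]) (auto simp: canonical_equation_def unknown_edges_iff)
  next
    case (trivalent_black v e2 e3 e1)
    then have "e0 \<in> in_arcs (dig N) v" by auto
    then have "e0 \<in> arcs (dig N)" "head (dig N) e0 = v" by (auto simp: in_arcs_def)
    with trivalent_black show ?thesis
      by (intro image_eqI[of _ _ e0]) (auto simp: canonical_equation_def unknown_edges_iff)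
  next
    case (trivalent_white v e1 e2)
    then have "e0 \<in> arcs (dig N)" "head (dig N) e0 = v" by (auto simp: in_arcs_def)
    with trivalent_white show ?thesis
      by (intro image_eqI[of _ _ e0]) (auto simp: canonical_equation_def unknown_edges_iff)
  qed
  then show "x \<in> canonical_equation l ` unknown_edges N" by (simp add: x)
next
  fix x assume "x \<in> canonical_equation l ` unknown_edges N"
  then obtain e where e: "e \<in> unknown_edges N" "x = canonical_equation l e" by blast
  define v where "v = head (dig N) e"
  have v: "v \<in> internal_verts N" and ein: "e \<in> in_arcs (dig N) v"
    using e(1) unknown_edges_iff[of e] unfolding v_def unknown_edges_def in_arcs_def by blast+
  have deg: "card (in_arcs (dig N) v) + card (out_arcs (dig N) v) \<in> {2, 3}"
    using internal_degree[OF v] by (simp add: in_degree_def out_degree_def)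
  have x: "x = (e, \<lambda>f. if f \<in> out_arcs (dig N) v then edge_coeff N l e f else 0)"
    by (simp add: e canonical_equation_def v_def)
  show "x \<in> vertex_equations N l"
  proof (cases "vcolour N v")
    case White
    then have "card (in_arcs (dig N) v) = 1" using perfect[OF v] by (simp add: in_degree_def)
    then have ie: "in_arcs (dig N) v = {e}" using ein by (metis card_1_singletonE singletonD)
    with deg consider "card (out_arcs (dig N) v) = 1" | "card (out_arcs (dig N) v) = 2" by auto
    then show ?thesis
    proof cases
      case 1
      then obtain f where f: "out_arcs (dig N) v = {f}" by (rule card_1_singletonE)
      have "x = (e, (\<lambda>_. 0)(f := edge_coeff N l e f))" by (auto simp: x f)
      then show ?thesis using vertex_equations.bivalent[OF v ie f] by simp
    next
      case 2
      then obtain e1 e2 where f: "out_arcs (dig N) v = {e1, e2}" "e1 \<noteq> e2"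
        by (auto simp: card_2_iff)
      have "x = (e, (\<lambda>_. 0)(e1 := edge_coeff N l e e1, e2 := edge_coeff N l e e2))"
        by (auto simp: x f)
      then show ?thesis using vertex_equations.trivalent_white[OF v White ie f] by simp
    qed
  next
    case Black
    then have "card (out_arcs (dig N) v) = 1" using perfect[OF v] by (simp add: out_degree_def)
    then obtain f where f: "out_arcs (dig N) v = {f}" by (rule card_1_singletonE)
    have xf: "x = (e, (\<lambda>_. 0)(f := edge_coeff N l e f))" by (auto simp: x f)
    from deg f consider "card (in_arcs (dig N) v) = 1" | "card (in_arcs (dig N) v) = 2" by auto
    then show ?thesis
    proof cases
      case 1
      then have "in_arcs (dig N) v = {e}" using ein by (metis card_1_singletonE singletonD)
      then show ?thesis using vertex_equations.bivalent[OF v _ f] xf by simp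
    next
      case 2
      then obtain e2 e3 where i: "in_arcs (dig N) v = {e2, e3}" "e2 \<noteq> e3"
        by (auto simp: card_2_iff)
      then have "e \<in> {e2, e3}" using ein by simp
      then show ?thesis using vertex_equations.trivalent_black[OF v Black i f] xf by simp
    qed
  qed
qed

lemma fst_canonical_equation [simp]: "fst (canonical_equation l e) = e"
  by (simp add: canonical_equation_def)

lemma inj_canonical_equation: "inj (canonical_equation l)"
  by (rule inj_on_inverseI[of _ fst]) simp

text \<open>An equation is determined by the edge on its left-hand side, so ordering the equations
  amounts to ordering the unknown edges.\<close>

lemma map_fst_equations:
  assumes "qs \<in> permutations_of_set (vertex_equations N l)"
  shows "map fst qs \<in> permutations_of_set (unknown_edges N)"
    and "qs = map (canonical_equation l) (map fst qs)"
proof -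
  have qs: "set qs = canonical_equation l ` unknown_edges N" "distinct qs"
    using assms by (auto simp: permutations_of_set_def vertex_equations_eq)
  have c: "canonical_equation l (fst q) = q" if "q \<in> set qs" for q
    using that qs by auto
  show eq: "qs = map (canonical_equation l) (map fst qs)"
    using c by (simp add: map_idI)
  have "distinct (map fst qs)"
    using qs(2) eq by (metis distinct_map)
  then show "map fst qs \<in> permutations_of_set (unknown_edges N)"
    using qs(1) by (auto simp: permutations_of_set_def image_image)
qed

lemma ex1_equation_order:
  assumes "es \<in> permutations_of_set (unknown_edges N)"
  shows "\<exists>!qs. qs \<in> permutations_of_set (vertex_equations N l) \<and> map fst qs = es"
proof (rule ex1I[of _ "map (canonical_equation l) es"])
  show "map (canonical_equation l) es \<in> permutations_of_set (vertex_equations N l) \<and>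
      map fst (map (canonical_equation l) es) = es"
    using assms inj_on_subset[OF inj_canonical_equation]
    by (auto simp: permutations_of_set_def vertex_equations_eq distinct_map o_def)
next
  fix qs assume "qs \<in> permutations_of_set (vertex_equations N l) \<and> map fst qs = es"
  then show "qs = map (canonical_equation l) es" using map_fst_equations(2) by blast
qed

text \<open>An internal vertex has a single arc on one side, so a balanced set uses at most one arc
  in and one out there; this yields unique successors and predecessors. Conversely, these give equal
  counts, and a tail is internal as the head of the predecessor.\<close>

lemma conservative_flows_eq:
  "conservative_flows N =
     {C. C \<subseteq> unknown_edges N \<and> successor_closed (tail (dig N)) (head (dig N)) C}"
proof (rule equalityI; rule subsetI)
  fix C assume "C \<in> conservative_flows N"
  then have CA: "C \<subseteq> arcs (dig N)"
    and bd: "\<And>e. e \<in> C \<Longrightarrow> tail (dig N) e \<notin> bd_verts N \<and> head (dig N) e \<notin> bd_verts N"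
    and eq: "\<And>v. v \<in> internal_verts N \<Longrightarrow>
      card (C \<inter> in_arcs (dig N) v) = card (C \<inter> out_arcs (dig N) v)"
    unfolding conservative_flows_def by auto
  have int: "tail (dig N) e \<in> internal_verts N" "head (dig N) e \<in> internal_verts N" if "e \<in> C" for e
    using that bd CA by (auto simp: internal_verts_def)
  have one: "card (C \<inter> in_arcs (dig N) v) = 1 \<and> card (C \<inter> out_arcs (dig N) v) = 1"
    if v: "v \<in> internal_verts N" and ne: "C \<inter> in_arcs (dig N) v \<noteq> {} \<or> C \<inter> out_arcs (dig N) v \<noteq> {}" for v
  proof -
    have "card (C \<inter> in_arcs (dig N) v) \<le> card (in_arcs (dig N) v)"
      "card (C \<inter> out_arcs (dig N) v) \<le> card (out_arcs (dig N) v)"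
      by (simp_all add: card_mono G.finite_in_arcs G.finite_out_arcs)
    moreover have "card (C \<inter> in_arcs (dig N) v) \<noteq> 0 \<or> card (C \<inter> out_arcs (dig N) v) \<noteq> 0"
      using ne by (auto simp: G.finite_in_arcs G.finite_out_arcs)
    ultimately show ?thesis using unique_in_or_out[OF v] eq[OF v] by linarith
  qed
  have ex1: "\<exists>!x. x \<in> C \<and> x \<in> X" if "card (C \<inter> X) = 1" for X
    using that by (metis IntD1 IntD2 IntI card_1_singletonE singletonD singletonI)
  have "successor_closed (tail (dig N)) (head (dig N)) C"
    unfolding successor_closed_def
  proof (intro conjI ballI)
    fix i assume i: "i \<in> C"
    then have "C \<inter> in_arcs (dig N) (head (dig N) i) \<noteq> {}" using CA by (auto simp: in_arcs_def)
    then have "\<exists>!x. x \<in> C \<and> x \<in> out_arcs (dig N) (head (dig N) i)"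
      using one int(2)[OF i] ex1 by blast
    then show "\<exists>!j. j \<in> C \<and> tail (dig N) j = head (dig N) i"
      using CA by (auto simp: out_arcs_def)
  next
    fix j assume j: "j \<in> C"
    then have "C \<inter> out_arcs (dig N) (tail (dig N) j) \<noteq> {}" using CA by (auto simp: out_arcs_def)
    then have "\<exists>!x. x \<in> C \<and> x \<in> in_arcs (dig N) (tail (dig N) j)"
      using one int(1)[OF j] ex1 by blast
    then show "\<exists>!i. i \<in> C \<and> head (dig N) i = tail (dig N) j"
      using CA by (auto simp: in_arcs_def)
  qed
  then show "C \<in> {C. C \<subseteq> unknown_edges N \<and> successor_closed (tail (dig N)) (head (dig N)) C}"
    using int CA unknown_edges_iff by blast
next
  fix C assume "C \<in> {C. C \<subseteq> unknown_edges N \<and> successor_closed (tail (dig N)) (head (dig N)) C}"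
  then have CU: "C \<subseteq> unknown_edges N"
    and s1: "\<And>i. i \<in> C \<Longrightarrow> \<exists>!j. j \<in> C \<and> tail (dig N) j = head (dig N) i"
    and s2: "\<And>j. j \<in> C \<Longrightarrow> \<exists>!i. i \<in> C \<and> head (dig N) i = tail (dig N) j"
    by (auto simp: successor_closed_def)
  have CA: "C \<subseteq> arcs (dig N)" using CU by (auto simp: unknown_edges_def)
  have h: "head (dig N) e \<in> internal_verts N" if "e \<in> C" for e
    using unknown_edges_iff that CU CA by blast
  have t: "tail (dig N) e \<in> internal_verts N" if "e \<in> C" for e
    using s2[OF that] h by metis
  have "card (C \<inter> in_arcs (dig N) v) = card (C \<inter> out_arcs (dig N) v)" for v
  proof (cases "C \<inter> in_arcs (dig N) v = {}")
    case True
    then have "C \<inter> out_arcs (dig N) v = {}"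
      using s2 CA by (fastforce simp: in_arcs_def out_arcs_def)
    with True show ?thesis by simp
  next
    case False
    then obtain i where i: "i \<in> C" "head (dig N) i = v" by (auto simp: in_arcs_def)
    obtain j where j: "j \<in> C" "tail (dig N) j = v" using s1[OF i(1)] i(2) by metis
    have "C \<inter> out_arcs (dig N) v = {j}"
      using s1[OF i(1)] i j CA by (auto simp: out_arcs_def)
    moreover have "C \<inter> in_arcs (dig N) v = {i}"
      using s2[OF j(1)] i j CA by (auto simp: in_arcs_def)
    ultimately show ?thesis by simp
  qed
  then show "C \<in> conservative_flows N"
    using CA h t unfolding conservative_flows_def internal_verts_def by blast
qed

end

text \<open>Only the parity of the winding number matters: 1 and -1 both give the factor -1.\<close>

lemma edge_coeff_eq:
  "edge_coeff N l e f = (- 1) ^ int_num N l e *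
     (if turns_through l (edge_vec N e) (edge_vec N f) then - 1 else 1) * weight N e"
proof -
  have "(- 1 :: real) powi wind N l e f = (if turns_through l (edge_vec N e) (edge_vec N f) then - 1 else 1)"
    by (simp add: wind_def turns_through_def Let_def power_int_minus)
  then show ?thesis by (simp add: edge_coeff_def power_int_add)
qed

text \<open>The midpoint would be an end. This serves to exclude flows that run along an edge and
  straight back.\<close>

lemma closed_segment_subset_ends_imp_eq:
  fixes a b :: "'a::euclidean_space"
  assumes "closed_segment a b \<subseteq> {a, b}"
  shows "a = b"
proof -
  have "midpoint a b \<in> closed_segment a b" by simp
  then have "midpoint a b = a \<or> midpoint a b = b" using assms by blast
  then show ?thesis by (auto simp: midpoint_eq_endpoint)
qed

section \<open>Signs, weights and the determinant\<close>

context plabic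
begin

text \<open>Exchanging the sums over edges and over sources reduces the claim to a single gauge ray,
  which crosses the closed polygons an even number of times.\<close>

lemma even_int_num_closed_polygons:
  assumes gauge: "gauge_direction N l" and S: "finite S" and p: "p permutes S"
    and inner: "\<And>u. u \<in> S \<Longrightarrow> tail (dig N) (e u) \<in> internal_verts N"
    and succ: "\<And>u. u \<in> S \<Longrightarrow> tail (dig N) (e (p u)) = head (dig N) (e u)"
  shows "even (\<Sum>u\<in>S. int_num N l (e u))"
proof -
  let ?Z = "\<lambda>u. tail (dig N) (e u)"
  have l: "l \<noteq> 0" using gauge by (simp add: gauge_direction_def)
  have src: "bd N i \<in> frontier (disk N)"
    "\<forall>\<^sub>F t in at_right 0. bd N i + t *\<^sub>R l \<in> interior (disk N)"
    "ray (bd N i) l \<inter> internal_verts N = {}" if "i \<in> source_idx N" for i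
    using gauge that bd_frontier[of i] unfolding gauge_direction_def bd_verts_def source_idx_def by auto
  have Z: "?Z u \<in> interior (disk N)" "i \<in> source_idx N \<Longrightarrow> ?Z u \<notin> ray (bd N i) l" if "u \<in> S" for u i
    using inner[OF that] internal_in_disk src(3)[of i] by auto
  have pS: "p u \<in> S \<longleftrightarrow> u \<in> S" for u
    by (rule permutes_in_image[OF p])
  have fin: "finite (source_idx N)" by (simp add: source_idx_def)
  have seg: "edge_segment N (e u) = closed_segment (?Z u) (?Z (p u))" if "u \<in> S" for u
    using succ[OF that] by (simp add: edge_segment_def)
  have "int_num N l (e u) = (\<Sum>i\<in>source_idx N. card (ray (bd N i) l \<inter> closed_segment (?Z u) (?Z (p u))))"
    if u: "u \<in> S" for u
  proof -
    \<comment> \<open>Finitely many crossings per ray let the cardinality in \<open>int_num\<close>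
      be computed as a sum over the sources.\<close>
    have "finite (ray (bd N i) l \<inter> closed_segment (?Z u) (?Z (p u)))" if i: "i \<in> source_idx N" for i
      by (rule ray_inter_segment(1)[OF convex_disk src(1)[OF i] l src(2)[OF i]
            Z(1)[OF u] Z(2)[OF u i] Z(1) Z(2)[OF _ i]]) (simp_all add: pS u)
    then show ?thesis
      unfolding int_num_def seg[OF u] using fin by (intro card_SigmaI) auto
  qed
  then have "(\<Sum>u\<in>S. int_num N l (e u)) =
     (\<Sum>u\<in>S. \<Sum>i\<in>source_idx N. card (ray (bd N i) l \<inter> closed_segment (?Z u) (?Z (p u))))"
    by (rule sum.cong[OF refl])
  also have "\<dots> = (\<Sum>i\<in>source_idx N. \<Sum>u\<in>S. card (ray (bd N i) l \<inter> closed_segment (?Z u) (?Z (p u))))"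
    by (rule sum.swap)
  also have "even \<dots>"
  proof (rule dvd_sum)
    fix i assume i: "i \<in> source_idx N"
    show "even (\<Sum>u\<in>S. card (ray (bd N i) l \<inter> closed_segment (?Z u) (?Z (p u))))"
      by (rule even_ray_crossings[where Z = ?Z, OF convex_disk src(1)[OF i] l src(2)[OF i] p Z(1) Z(2)[OF _ i]])
  qed
  finally show ?thesis .
qed

text \<open>The sign of the number of edges and the turning factors occur both in
  \<open>sign p\<close> and in the product of coefficients, so they cancel as squares. The gauge
  intersections add up to an even number, and only the weights remain.\<close>

lemma flow_term:
  assumes gauge: "gauge_direction N l"
    and es: "es \<in> permutations_of_set (unknown_edges N)"
    and p: "p \<in> transition_perms (length es) (\<lambda>i. tail (dig N) (es ! i)) (\<lambda>i. head (dig N) (es ! i))"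
    and sc: "successor_closed (\<lambda>i. tail (dig N) (es ! i)) (\<lambda>i. head (dig N) (es ! i)) {i. p i \<noteq> i}"
  shows "signof p * (\<Prod>i | p i \<noteq> i. - edge_coeff N l (es ! i) (es ! p i)) =
    (\<Prod>i | p i \<noteq> i. weight N (es ! i))"
proof -
  let ?t = "\<lambda>i. tail (dig N) (es ! i)" and ?h = "\<lambda>i. head (dig N) (es ! i)"
  define S where "S = {i. p i \<noteq> i}"
  have dist: "distinct es" and set: "set es = unknown_edges N"
    using es by (auto simp: permutations_of_set_def)
  have pn: "p permutes {0..<length es}" using p by (simp add: transition_perms_def)
  have pp: "p permutes S" unfolding S_def by (rule moved_permutes[OF pn])
  have Sn: "i < length es" if "i \<in> S" for i
    using that pn by (auto simp: S_def dest: permutes_not_in)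
  then have fin: "finite S" by (meson finite_nat_iff_bounded lessThan_iff subsetI)
  have pS: "p i \<in> S \<longleftrightarrow> i \<in> S" for i
    by (rule permutes_in_image[OF pp])
  have th: "?t (p i) = ?h i" if "i \<in> S" for i
    using p that Sn[OF that] by (simp add: transition_perms_def S_def)
  have U: "es ! i \<in> unknown_edges N" if "i \<in> S" for i
    using Sn[OF that] set nth_mem by blast
  then have arc: "es ! i \<in> arcs (dig N)" if "i \<in> S" for i
    using that by (simp add: unknown_edges_def)
  have s1: "\<exists>!j. j \<in> S \<and> ?t j = ?h i" if "i \<in> S" for i
    using sc that by (simp add: successor_closed_def S_def)
  have s2: "\<exists>!i. i \<in> S \<and> ?h i = ?t j" if "j \<in> S" for j
    using sc that by (simp add: successor_closed_def S_def)
  have inj: "inj_on ?t S"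
  proof (rule inj_onI)
    fix i j assume ij: "i \<in> S" "j \<in> S" "?t i = ?t j"
    obtain k where "k \<in> S" "?h k = ?t i" using s2[OF ij(1)] by blast
    with s1[of k] ij show "i = j" by metis
  qed
  have inner: "?t i \<in> internal_verts N" if i: "i \<in> S" for i
  proof -
    obtain k where "k \<in> S" "?h k = ?t i" using s2[OF i] by blast
    then show ?thesis using unknown_edges_iff[OF arc] U by metis
  qed
  have seg: "closed_segment (?t u) (?t (p u)) \<inter> closed_segment (?t v) (?t (p v))
      \<subseteq> {?t u, ?t (p u)} \<inter> {?t v, ?t (p v)}" if uv: "u \<in> S" "v \<in> S" "u \<noteq> v" for u v
  proof -
    have "es ! u \<noteq> es ! v" using uv Sn dist by (simp add: nth_eq_iff_index_eq)
    then show ?thesis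
      using embedding arc[OF uv(1)] arc[OF uv(2)]
      unfolding straight_embedding_def th[OF uv(1)] th[OF uv(2)] by blast
  qed
  have p_neq: "p u \<noteq> u" if "u \<in> S" for u using that by (simp add: S_def)
  \<comment> \<open>Two opposite arcs between the same vertices would be drawn as one segment, which
    the embedding forbids.\<close>
  have pp_neq: "p (p u) \<noteq> u" if u: "u \<in> S" for u
  proof
    assume "p (p u) = u"
    then have "closed_segment (?t u) (?t (p u)) \<subseteq> {?t u, ?t (p u)}"
      using seg[of u "p u"] u pS p_neq[OF u] by (auto simp: closed_segment_commute)
    then have "?t u = ?t (p u)" by (rule closed_segment_subset_ends_imp_eq)
    then show False using tail_neq_head[OF arc[OF u]] th[OF u] by simp
  qed
  have vec: "?t (p u) - ?t u = edge_vec N (es ! u)" if "u \<in> S" for u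
    using th[OF that] by (simp add: edge_vec_def)
  let ?T = "\<lambda>u. turns_through l (edge_vec N (es ! u)) (edge_vec N (es ! p u))"
  have "sign p = (- 1) ^ card S *
    (\<Prod>u\<in>S. if turns_through l (?t (p u) - ?t u) (?t (p (p u)) - ?t (p u)) then - 1 else 1)"
  proof (rule sign_closed_polygons[OF fin pp inj p_neq pp_neq seg])
    show "l \<noteq> 0" using gauge by (simp add: gauge_direction_def)
    show "orient (?t (p u) - ?t u) l \<noteq> 0" if "u \<in> S" for u
      using gauge arc[OF that] unfolding vec[OF that] gauge_direction_def by blast
  qed
  also have "(\<Prod>u\<in>S. if turns_through l (?t (p u) - ?t u) (?t (p (p u)) - ?t (p u)) then - 1 else 1)
     = (\<Prod>u\<in>S. if ?T u then - 1 else (1 :: int))"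
    by (intro prod.cong refl) (simp add: vec pS)
  finally have sgn: "sign p = (- 1) ^ card S * (\<Prod>u\<in>S. if ?T u then - 1 else 1)" .
  have ev: "even (\<Sum>u\<in>S. int_num N l (es ! u))"
    by (rule even_int_num_closed_polygons[where e = "(!) es", OF gauge fin pp inner th])
  have "(\<Prod>i\<in>S. - edge_coeff N l (es ! i) (es ! p i)) = (\<Prod>i\<in>S. - 1 * (- 1) ^ int_num N l (es ! i) *
      (if ?T i then - 1 else 1) * weight N (es ! i))"
    by (simp add: edge_coeff_eq)
  also have "\<dots> = (- 1) ^ card S * (- 1) ^ (\<Sum>u\<in>S. int_num N l (es ! u)) *
      (\<Prod>u\<in>S. if ?T u then - 1 else 1) * (\<Prod>i\<in>S. weight N (es ! i))"
    by (simp only: prod.distrib power_sum prod_constant)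
  also have "(- 1 :: real) ^ (\<Sum>u\<in>S. int_num N l (es ! u)) = 1" using ev by simp
  also have "(\<Prod>u\<in>S. if ?T u then - 1 else (1 :: real)) = of_int (\<Prod>u\<in>S. if ?T u then - 1 else (1 :: int))"
    unfolding of_int_prod by (intro prod.cong) auto
  finally have "signof p * (\<Prod>i\<in>S. - edge_coeff N l (es ! i) (es ! p i)) =
     of_int (((- 1) ^ card S * (- 1) ^ card S) * ((\<Prod>u\<in>S. if ?T u then - 1 else (1 :: int)) *
       (\<Prod>u\<in>S. if ?T u then - 1 else (1 :: int)))) * (\<Prod>i\<in>S. weight N (es ! i))"
    unfolding sgn by simp
  also have "((- 1 :: int) ^ card S * (- 1) ^ card S) = 1"
    by (simp flip: power_mult_distrib)
  also have "(\<Prod>u\<in>S. if ?T u then - 1 else (1 :: int)) * (\<Prod>u\<in>S. if ?T u then - 1 else (1 :: int)) = 1"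
    unfolding prod.distrib[symmetric] by (intro prod.neutral) auto
  finally show ?thesis by (simp add: S_def)
qed

lemma system_matrix_canonical:
  "system_matrix (map (canonical_equation l) es') es = mat (length es') (length es)
     (\<lambda>(r, c). of_bool (es ! c = es' ! r) - snd (canonical_equation l (es' ! r)) (es ! c))"
  by (auto simp: system_matrix_def)

text \<open>The expansion runs over permutations of positions in \<open>es\<close>; their sets of
  moved positions correspond to the flows, and each surviving term is the weight of its
  flow.\<close>

theorem det_system_matrix:
  assumes gauge: "gauge_direction N l"
    and es: "es \<in> permutations_of_set (unknown_edges N)"
  shows "Determinant.det (system_matrix (map (canonical_equation l) es) es) =
    (\<Sum>C\<in>conservative_flows N. flow_weight N C)"
proof -
  let ?t = "\<lambda>i. tail (dig N) (es ! i)" and ?h = "\<lambda>i. head (dig N) (es ! i)"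
  let ?n = "length es"
  have dist: "distinct es" and set: "set es = unknown_edges N"
    using es by (auto simp: permutations_of_set_def)
  have U: "es ! i \<in> unknown_edges N" if "i < ?n" for i
    using that set nth_mem by blast
  then have arc: "es ! i \<in> arcs (dig N)" if "i < ?n" for i
    using that by (simp add: unknown_edges_def)
  have lf: "?t i \<noteq> ?h i" if "i < ?n" for i using tail_neq_head[OF arc[OF that]] .
  have nth: "es ! i = es ! j \<longleftrightarrow> i = j" if "i < ?n" "j < ?n" for i j
    using that dist by (simp add: nth_eq_iff_index_eq)
  \<comment> \<open>This is perfection at the common vertex \<open>?h i\<close>.\<close>
  have branch: "i = j \<or> i' = j'"
    if n: "i < ?n" "j < ?n" "i' < ?n" "j' < ?n" and e: "?h i = ?h j" "?t i' = ?h i" "?t j' = ?h i"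
    for i j i' j'
  proof -
    have v: "?h i \<in> internal_verts N" using unknown_edges_iff[OF arc] U n by blast
    have "es ! i \<in> in_arcs (dig N) (?h i)" "es ! j \<in> in_arcs (dig N) (?h i)"
      "es ! i' \<in> out_arcs (dig N) (?h i)" "es ! j' \<in> out_arcs (dig N) (?h i)"
      using arc n e by (simp_all add: in_arcs_def out_arcs_def)
    then have "es ! i = es ! j \<or> es ! i' = es ! j'"
      using unique_in_or_out[OF v] by (metis card_1_singletonE singletonD)
    then show ?thesis using nth n by blast
  qed
  have "system_matrix (map (canonical_equation l) es) es = mat ?n ?n
     (\<lambda>(i, j). of_bool (j = i) - (if ?t j = ?h i then edge_coeff N l (es ! i) (es ! j) else 0))"
    unfolding system_matrix_canonical
    by (rule eq_matI) (auto simp: nth arc canonical_equation_def out_arcs_def)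
  also have "Determinant.det \<dots> = (\<Sum>p\<in>transition_perms ?n ?t ?h.
      signof p * (\<Prod>i | p i \<noteq> i. - edge_coeff N l (es ! i) (es ! p i)))"
    by (rule det_transition_matrix[of ?n ?t ?h "\<lambda>i j. edge_coeff N l (es ! i) (es ! j)", OF lf])
  also have "\<dots> = (\<Sum>p\<in>transition_perms ?n ?t ?h. \<Prod>i | p i \<noteq> i. weight N (es ! i))"
  proof (intro sum.cong refl)
    fix p assume p: "p \<in> transition_perms ?n ?t ?h"
    have "successor_closed ?t ?h {i. p i \<noteq> i}"
      using bij_betwE[OF bij_betw_transition_perms[of ?n ?t ?h, OF lf branch]] p by blast
    then show "signof p * (\<Prod>i | p i \<noteq> i. - edge_coeff N l (es ! i) (es ! p i)) =
        (\<Prod>i | p i \<noteq> i. weight N (es ! i))"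
      by (rule flow_term[OF gauge es p])
  qed
  also have "\<dots> = (\<Sum>C | C \<subseteq> {..<?n} \<and> successor_closed ?t ?h C. \<Prod>i\<in>C. weight N (es ! i))"
    by (rule sum.reindex_bij_betw[OF bij_betw_transition_perms[of ?n ?t ?h, OF lf branch],
          of "\<lambda>C. \<Prod>i\<in>C. weight N (es ! i)"])
  also have "\<dots> = (\<Sum>C\<in>conservative_flows N. flow_weight N C)"
  proof -
    \<comment> \<open>Sets of positions are carried over to sets of edges by the injective indexing
      of \<open>es\<close>.\<close>
    have inj: "inj_on ((!) es) {..<?n}" using dist by (simp add: inj_on_nth)
    have im: "(!) es ` {..<?n} = unknown_edges N"
      using set by (auto simp: set_conv_nth)
    have sc: "successor_closed ?t ?h C \<longleftrightarrow> successor_closed (tail (dig N)) (head (dig N)) ((!) es ` C)"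
      if C: "C \<subseteq> {..<?n}" for C
    proof -
      have "(\<exists>!x. x \<in> (!) es ` C \<and> P x) \<longleftrightarrow> (\<exists>!i. i \<in> C \<and> P (es ! i))" for P
      proof
        assume "\<exists>!i. i \<in> C \<and> P (es ! i)"
        then show "\<exists>!x. x \<in> (!) es ` C \<and> P x" by blast
      next
        assume *: "\<exists>!x. x \<in> (!) es ` C \<and> P x"
        then obtain i where i: "i \<in> C" "P (es ! i)" by blast
        have "j = i" if "j \<in> C" "P (es ! j)" for j
        proof -
          have "es ! j = es ! i" using * i that by blast
          then show ?thesis using inj_onD[OF inj] C i(1) that(1) by blast
        qed
        with i show "\<exists>!i. i \<in> C \<and> P (es ! i)" by blast
      qed
      then show ?thesis unfolding successor_closed_def by simp
    qed
    have "bij_betw ((`) ((!) es)) {C. C \<subseteq> {..<?n} \<and> successor_closed ?t ?h C} (conservative_flows N)"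
    proof (rule bij_betw_imageI)
      show "inj_on ((`) ((!) es)) {C. C \<subseteq> {..<?n} \<and> successor_closed ?t ?h C}"
        by (rule inj_on_subset[OF inj_on_image_Pow[OF inj]]) auto
      show "(`) ((!) es) ` {C. C \<subseteq> {..<?n} \<and> successor_closed ?t ?h C} = conservative_flows N"
        unfolding conservative_flows_eq im[symmetric]
      proof (rule equalityI; rule subsetI)
        fix F assume "F \<in> {C. C \<subseteq> (!) es ` {..<?n} \<and> successor_closed (tail (dig N)) (head (dig N)) C}"
        then obtain C where "C \<subseteq> {..<?n}" "F = (!) es ` C"
          "successor_closed (tail (dig N)) (head (dig N)) F"
          by (auto simp: subset_image_iff)
        with sc show "F \<in> (`) ((!) es) ` {C. C \<subseteq> {..<?n} \<and> successor_closed ?t ?h C}" by blast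
      qed (use sc in auto)
    qed
    then have "(\<Sum>C | C \<subseteq> {..<?n} \<and> successor_closed ?t ?h C. flow_weight N ((!) es ` C)) =
      (\<Sum>C\<in>conservative_flows N. flow_weight N C)"
      by (rule sum.reindex_bij_betw)
    moreover have "flow_weight N ((!) es ` C) = (\<Prod>i\<in>C. weight N (es ! i))" if "C \<subseteq> {..<?n}" for C
      unfolding flow_weight_def using inj_on_subset[OF inj that] by (simp add: prod.reindex)
    ultimately show ?thesis by (metis (mono_tags, lifting) mem_Collect_eq sum.cong)
  qed
  finally show ?thesis .
qed

text \<open>All weights are positive and the trivial flow is always present; hence the determinant
  does not vanish.\<close>

lemma flow_sum_pos: "(\<Sum>C\<in>conservative_flows N. flow_weight N C) > 0"
proof (rule sum_pos)
  show "finite (conservative_flows N)"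
    by (rule finite_subset[of _ "Pow (arcs (dig N))"]) (auto simp: conservative_flows_def)
  have "{} \<in> conservative_flows N" by (simp add: conservative_flows_def)
  then show "conservative_flows N \<noteq> {}" by blast
  show "flow_weight N C > 0" if "C \<in> conservative_flows N" for C
    using that weight_pos by (auto simp: flow_weight_def conservative_flows_def intro!: prod_pos)
qed

text \<open>For arbitrary orders the matrix differs from the properly ordered one by a permutation
  of rows, which affects only the sign of the determinant.\<close>

lemma det_system_matrix_nonzero:
  assumes gauge: "gauge_direction N l"
    and qs: "qs \<in> permutations_of_set (vertex_equations N l)"
    and es: "es \<in> permutations_of_set (unknown_edges N)"
  shows "Determinant.det (system_matrix qs es) \<noteq> 0"
proof -
  define es' where "es' = map fst qs"
  have es': "es' \<in> permutations_of_set (unknown_edges N)" and qs': "qs = map (canonical_equation l) es'"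
    using map_fst_equations[OF qs] by (simp_all add: es'_def)
  have "mset es' = mset es"
    using es es' by (metis permutations_of_setD set_eq_iff_mset_eq_distinct)
  then obtain s where s: "s permutes {..<length es}" "permute_list s es = es'"
    by (rule mset_eq_permutation)
  have len: "length es' = length es" using s by auto
  have nth: "es' ! i = es ! s i" if "i < length es" for i
    using permute_list_nth[OF s(1) that] s(2) by simp
  have sl: "s i < length es" if "i < length es" for i
    using permutes_in_image[OF s(1), of i] that by simp
  define A where "A = system_matrix (map (canonical_equation l) es) es"
  have A: "A \<in> carrier_mat (length es) (length es)" by (simp add: A_def system_matrix_def)
  have "system_matrix qs es = mat (length es) (length es) (\<lambda>(i, j). A $$ (s i, j))"
    unfolding qs' A_def system_matrix_canonical
    by (rule eq_matI) (auto simp: len nth sl)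
  then have "Determinant.det (system_matrix qs es) = signof s * Determinant.det A"
    using det_permute_rows[OF A, of s] s(1) by (simp add: atLeast0LessThan)
  moreover have "Determinant.det A \<noteq> 0"
    using det_system_matrix[OF gauge es] flow_sum_pos by (simp add: A_def)
  ultimately show ?thesis by (simp add: sign_def)
qed

text \<open>The conditions at the sinks prescribe exactly the vectors on the arcs that are not
  unknown; the remaining equations form a square system with nonzero determinant.\<close>

lemma ex1_edge_vectors:
  fixes B :: "nat \<Rightarrow> 'v::real_vector"
  assumes gauge: "gauge_direction N l"
  shows "\<exists>!E. E \<in> extensional (arcs (dig N)) \<and> edge_vectors N l B E"
proof -
  obtain es where es: "es \<in> permutations_of_set (unknown_edges N)"
    using finite_distinct_list[OF finite_unknown_edges] by (auto intro: permutations_of_setI)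
  then have dist: "distinct es" and set: "set es = unknown_edges N"
    by (auto simp: permutations_of_set_def)
  \<comment> \<open>The sink index is recovered from the head of the arc, as the boundary vertices
    are distinct.\<close>
  define G where "G e = ((-1) ^ int_num N l e * weight N e) *\<^sub>R
     B (the_inv_into {1..bd_num N} (bd N) (head (dig N) e))" for e
  define a where "a e = snd (canonical_equation l e)" for e
  have sub: "set es \<subseteq> arcs (dig N)" unfolding set by (auto simp: unknown_edges_def)
  have inv: "the_inv_into {1..bd_num N} (bd N) (bd N j) = j" if "j \<in> sink_idx N" for j
    using that inj_bd by (intro the_inv_into_f_f) (auto simp: sink_idx_def)
  have sinks: "(\<forall>j\<in>sink_idx N. \<forall>e\<in>in_arcs (dig N) (bd N j).
        E e = ((-1) ^ int_num N l e * weight N e) *\<^sub>R B j) \<longleftrightarrow>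
     (\<forall>e\<in>arcs (dig N) - set es. E e = G e)" for E :: "'e \<Rightarrow> 'v"
  proof -
    have K: "arcs (dig N) - set es = (\<Union>j\<in>sink_idx N. in_arcs (dig N) (bd N j))"
      unfolding set by (auto simp: unknown_edges_def in_arcs_def)
    have "G e = ((-1) ^ int_num N l e * weight N e) *\<^sub>R B j"
      if "j \<in> sink_idx N" "e \<in> in_arcs (dig N) (bd N j)" for e j
      using that inv[OF that(1)] by (simp add: G_def in_arcs_def)
    then show ?thesis unfolding K by auto
  qed
  have "edge_vectors N l B E \<longleftrightarrow> (\<forall>e\<in>arcs (dig N) - set es. E e = G e) \<and>
    (\<forall>e\<in>set es. E e = (\<Sum>f\<in>arcs (dig N). a e f *\<^sub>R E f))" for E
    unfolding edge_vectors_def sinks vertex_equations_eq set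
    by (simp add: canonical_equation_def a_def)
  moreover have "Determinant.det (mat (length es) (length es)
      (\<lambda>(r, c). of_bool (es ! c = es ! r) - a (es ! r) (es ! c))) \<noteq> 0"
    using det_system_matrix[OF gauge es] flow_sum_pos
    unfolding system_matrix_canonical a_def by simp
  ultimately show ?thesis
    using ex1_vector_solution[OF G.finite_arcs sub dist] by simp
qed

end

theorem theorem3p11:
  fixes N :: "'e plabic_network"
    and l :: complex
    and B :: "nat \<Rightarrow> 'v::real_vector"
  assumes "plabic N"
    and "gauge_direction N l"
    and "inj_on B (sink_idx N)"
    and "independent (B ` sink_idx N)"
  shows "finite (unknown_edges N) \<and> finite (vertex_equations N l) \<and>
         card (vertex_equations N l) = card (unknown_edges N) \<and>
         (\<forall>qs \<in> permutations_of_set (vertex_equations N l).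
            \<forall>es \<in> permutations_of_set (unknown_edges N).
              vec_space.rank (length qs) (system_matrix qs es) = card (unknown_edges N)) \<and>
         (\<exists>!E. E \<in> extensional (arcs (dig N)) \<and> edge_vectors N l B E) \<and>
         (\<forall>es \<in> permutations_of_set (unknown_edges N).
            \<exists>!qs. qs \<in> permutations_of_set (vertex_equations N l) \<and> map fst qs = es) \<and>
         (\<forall>es \<in> permutations_of_set (unknown_edges N).
            \<forall>qs \<in> permutations_of_set (vertex_equations N l). map fst qs = es \<longrightarrow>
              Determinant.det (system_matrix qs es) =
                (\<Sum>C\<in>conservative_flows N. flow_weight N C))"
proof -
  interpret plabic N by (rule assms(1))
  note gauge = assms(2)
  have card: "card (vertex_equations N l) = card (unknown_edges N)"
    unfolding vertex_equations_eq
    by (intro card_image inj_on_subset[OF inj_canonical_equation]) simp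
  have rank: "vec_space.rank (length qs) (system_matrix qs es) = card (unknown_edges N)"
    if qs: "qs \<in> permutations_of_set (vertex_equations N l)"
      and es: "es \<in> permutations_of_set (unknown_edges N)" for qs es
  proof -
    have len: "length es = card (unknown_edges N)" "length qs = card (unknown_edges N)"
      using length_finite_permutations_of_set[OF es] length_finite_permutations_of_set[OF qs] card
      by simp_all
    then have "system_matrix qs es \<in> carrier_mat (length qs) (length qs)"
      by (simp add: system_matrix_def)
    then have "vec_space.rank (length qs) (system_matrix qs es) = length qs"
      using vec_space.det_rank_iff det_system_matrix_nonzero[OF gauge qs es] by blast
    then show ?thesis using len by simp
  qed
  \<comment> \<open>Prescribing the left-hand sides in the order \<open>es\<close> makes
    \<open>qs\<close> the list of canonical equations along \<open>es\<close>.\<close>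
  have det: "Determinant.det (system_matrix qs es) = (\<Sum>C\<in>conservative_flows N. flow_weight N C)"
    if "qs \<in> permutations_of_set (vertex_equations N l)"
      "es \<in> permutations_of_set (unknown_edges N)" "map fst qs = es" for qs es
    using det_system_matrix[OF gauge that(2)] map_fst_equations(2)[OF that(1)] that(3) by simp
  have fin: "finite (vertex_equations N l)"
    unfolding vertex_equations_eq by (rule finite_imageI[OF finite_unknown_edges])
  show ?thesis
    by (intro conjI ballI impI finite_unknown_edges fin card ex1_edge_vectors[OF gauge];
        rule rank ex1_equation_order det)
qed

end
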